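(* Let $c>1$ and $p,q,r\ge0$ with $p+q+r=1$, $p+r>0$, $q+r>0$. For $k\in\mathbb{Z}$ the distributions $\rho^{(k)}$ and $\mu^{(k)}$ satisfy, for all $z\in\mathbb{R}$ and all Borel sets $B\subset\mathbb{R}$, $$\rho^{(k)}=\sum_{m=0}^\infty q^mp\,\delta_m+\sum_{m=0}^\infty q^mr\,\delta_{m+c^{-k}},$$ $$\widehat\rho^{(k)}(z)=\frac{p+re^{ic^{-k}z}}{1-qe^{iz}},$$ $$\widehat\mu^{(k)}(z)=\prod_{n=0}^\infty\frac{p+re^{ic^{-k-n}z}}{1-qe^{ic^{-n}z}},$$ $$\widehat\mu^{(k)}(z)=\widehat\mu^{(k+1)}(z)\left(\frac{p}{p+r}+\frac{r}{p+r}e^{ic^{-k}z}\right),$$ $$\mu^{(k)}(B)=\frac{p}{p+r}\mu^{(k+1)}(B)+\frac{r}{p+r}\mu^{(k+1)}(B-c^{-k}),$$ $$\widehat\mu^{(k+1)}(z)=\widehat\mu^{(k)}(c^{-1}z)\,\frac{1-q}{1-qe^{iz}}.$$ Further, the distribution $\rho^{(k)}$ is uniquely determined by $\mu^{(k)}$ and the relation $\widehat\mu^{(k)}(z)=\widehat\rho^{(k)}(z)\,\widehat\mu^{(k)}(c^{-1}z)$, $z\in\mathbb{R}$.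
   Context: For $k\in\mathbb{Z}$ let $\{(N_t^{(k)},L_t^{(k)}),t\ge0\}$ be the bivariate compound Poisson process (pure jump, no drift) with $E[e^{i(z_1N_t^{(k)}+z_2L_t^{(k)})}]=\exp[t\int_{\mathbb{R}^2}(e^{i(z_1x_1+z_2x_2)}-1)\nu^{(k)}(dx)]$, where $\nu^{(k)}$ is concentrated on the points $(1,0)$, $(0,1)$, $(1,c^{-k})$ with masses $u,v,w\ge0$ respectively, and $p=u/(u+v+w)$, $q=v/(u+v+w)$, $r=w/(u+v+w)$. Let $T$ be the first jump time of $\{N_t^{(k)}\}$. Define $\rho^{(k)}$ as the distribution of $L_T^{(k)}$, and $\mu^{(k)}$ as the distribution of $\int_0^{\infty-}c^{-N^{(k)}_{s-}}\,dL_s^{(k)}$ (the almost sure limit of $\int_0^t$ as $t\to\infty$, which exists). $\widehat\sigma$ denotes the characteristic function of $\sigma$, $\delta_x$ the Dirac measure at $x$, $B-a=\{x-a:x\in B\}$, and $q^0=1$ also when $q=0$. *)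

theory Defs
  imports "HOL-Probability.Probability"
begin

definition cadlag :: "(real \<Rightarrow> 'b::topological_space) \<Rightarrow> bool" where
  "cadlag f \<longleftrightarrow>
     (\<forall>t\<ge>0. (f \<longlongrightarrow> f t) (at_right t)) \<and>
     (\<forall>t>0. \<exists>l. (f \<longlongrightarrow> l) (at_left t))"

text \<open>Processes are indexed by \<open>real\<close>; only times \<open>t \<ge> 0\<close> are meaningful.\<close>

definition levy_process :: "'a measure \<Rightarrow> (real \<Rightarrow> 'a \<Rightarrow> 'b::euclidean_space) \<Rightarrow> bool" where
  "levy_process M X \<longleftrightarrow>
     prob_space M \<and>
     (\<forall>t\<ge>0. X t \<in> borel_measurable M) \<and>
     (\<forall>(n::nat) (t :: nat \<Rightarrow> real). 0 \<le> t 0 \<longrightarrow> (\<forall>j<n. t j < t (Suc j)) \<longrightarrow>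
        prob_space.indep_vars M (\<lambda>_. borel) (\<lambda>j \<omega>. X (t (Suc j)) \<omega> - X (t j) \<omega>) {..<n}) \<and>
     (AE \<omega> in M. X 0 \<omega> = 0) \<and>
     (\<forall>s\<ge>0. \<forall>t\<ge>0.
        distr M borel (\<lambda>\<omega>. X (s + t) \<omega> - X s \<omega>) = distr M borel (\<lambda>\<omega>. X t \<omega> - X 0 \<omega>)) \<and>
     (\<forall>t\<ge>0. \<forall>\<epsilon>>0.
        ((\<lambda>s. measure M {\<omega> \<in> space M. dist (X s \<omega>) (X t \<omega>) > \<epsilon>}) \<longlongrightarrow> 0) (at t within {0..})) \<and>
     (AE \<omega> in M. cadlag (\<lambda>t. X t \<omega>))"

definition compound_poisson_process ::
    "'a measure \<Rightarrow> (real \<Rightarrow> 'a \<Rightarrow> 'b::euclidean_space) \<Rightarrow> 'b measure \<Rightarrow> bool" where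
  "compound_poisson_process M X \<nu> \<longleftrightarrow>
     levy_process M X \<and>
     sets \<nu> = sets borel \<and> finite_measure \<nu> \<and> emeasure \<nu> {0} = 0 \<and>
     (\<forall>t\<ge>0. \<forall>z.
        (LINT \<omega>|M. iexp (z \<bullet> X t \<omega>)) = exp (of_real t * (LINT x|\<nu>. (iexp (z \<bullet> x) - 1))))"

definition three_point_measure ::
    "real \<Rightarrow> int \<Rightarrow> real \<Rightarrow> real \<Rightarrow> real \<Rightarrow> (real \<times> real) measure \<Rightarrow> bool" where
  "three_point_measure c k u v w \<nu> \<longleftrightarrow>
     sets \<nu> = sets borel \<and>
     emeasure \<nu> {(1, 0)} = ennreal u \<and>
     emeasure \<nu> {(0, 1)} = ennreal v \<and>
     emeasure \<nu> {(1, c powi (-k))} = ennreal w \<and>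
     emeasure \<nu> (- {(1, 0), (0, 1), (1, c powi (-k))}) = 0"

definition left_limit :: "(real \<Rightarrow> real) \<Rightarrow> real \<Rightarrow> real" where
  "left_limit f t = Lim (at_left t) f"

definition first_jump_time :: "(real \<Rightarrow> real) \<Rightarrow> real" where
  "first_jump_time f = Inf {t. t > 0 \<and> f t \<noteq> left_limit f t}"

text \<open>
  The integrator has jumps of positive size only, so almost surely its path is
  nondecreasing, right-continuous and of finite variation; the stochastic integral over
  \<open>(0, t]\<close> is therefore the pathwise Lebesgue-Stieltjes integral. As \<open>interval_measure\<close>
  expects a distribution function on the whole line, the path is extended to negative times
  by its value at \<open>0\<close>.
\<close>

definition exp_integral :: "real \<Rightarrow> (real \<Rightarrow> real) \<Rightarrow> (real \<Rightarrow> real) \<Rightarrow> real \<Rightarrow> real" where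
  "exp_integral c n l t =
     (LINT s:{0<..t}|interval_measure (\<lambda>s. l (max s 0)). c powr (- left_limit n s))"

definition improper_exp_integral :: "real \<Rightarrow> (real \<Rightarrow> real) \<Rightarrow> (real \<Rightarrow> real) \<Rightarrow> real" where
  "improper_exp_integral c n l = Lim at_top (exp_integral c n l)"

text \<open>
  Path properties hold only almost surely, so the functionals below agree with a random
  variable only up to a null set. Distributions are taken with respect to the completion of
  the underlying probability space, for which such functions are measurable.
\<close>

definition as_distr :: "'a measure \<Rightarrow> ('a \<Rightarrow> real) \<Rightarrow> real measure" where
  "as_distr M Z = distr (completion M) borel Z"

definition rho :: "'a measure \<Rightarrow> (real \<Rightarrow> 'a \<Rightarrow> real) \<Rightarrow> (real \<Rightarrow> 'a \<Rightarrow> real) \<Rightarrow> real measure" where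
  "rho M N L = as_distr M (\<lambda>\<omega>. L (first_jump_time (\<lambda>t. N t \<omega>)) \<omega>)"

definition mu :: "real \<Rightarrow> 'a measure \<Rightarrow> (real \<Rightarrow> 'a \<Rightarrow> real) \<Rightarrow> (real \<Rightarrow> 'a \<Rightarrow> real) \<Rightarrow> real measure" where
  "mu c M N L = as_distr M (\<lambda>\<omega>. improper_exp_integral c (\<lambda>t. N t \<omega>) (\<lambda>t. L t \<omega>))"

end

theory Submission
  imports Defs
begin

text \<open>For \<open>0 \<le> \<kappa> < 1\<close> consider \<open>I = \<integral> \<kappa>^N(s-) dL(s)\<close> over \<open>(0, \<infinity>)\<close>. For \<open>\<kappa> = 1 / c\<close> its law is \<open>\<mu>\<close>,
  and for \<open>\<kappa> = 0\<close>, with \<open>0^0 = 1\<close>, it is \<open>L\<close> at the first jump time of \<open>N\<close>, so its law is \<open>\<rho>\<close>.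
  On the grid of mesh \<open>h = 1 / m\<close> the left-endpoint sums of \<open>I\<close> are perpetuities with independent
  identically distributed steps, so their characteristic function satisfies
  \<open>\<Phi>(z) = E[exp(i z L(h)) \<Phi>(\<kappa>^N(h) z)]\<close>. Splitting according to \<open>N(h) = 0\<close>, \<open>N(h) = 1\<close> and
  \<open>N(h) \<ge> 2\<close>, dividing by \<open>h\<close> and letting \<open>h\<close> tend to 0 yields
  \<open>(u + v + w - v exp(i z)) \<Phi>(z) = (u + w exp(i d z)) \<Phi>(\<kappa> z)\<close> with \<open>d = c^(-k)\<close>.
  The case \<open>\<kappa> = 0\<close> gives the characteristic function of \<open>\<rho>\<close>; iterating the case \<open>\<kappa> = 1 / c\<close> gives
  the infinite product for that of \<open>\<mu>\<close>, and everything else follows by uniqueness of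
  characteristic functions. The zeros of the product are countable, hence \<open>\<rho>\<close> is unique.\<close>

section \<open>Perpetuities\<close>

text \<open>Conditioning at the random time \<open>T\<close> would call for a strong Markov
  property, while \<open>levy_process\<close> speaks only of increments between deterministic times.
  This is why the integral is discretised: each grid step is an increment over a fixed interval, and
  the fixed-point equation holds exactly on every grid before the mesh is refined. A second obstacle
  is that the process is specified through its characteristic function, so nothing is given about
  the jumps of a path. Integrality of \<open>N\<close> and nonnegativity of the increments of
  \<open>L\<close> come from comparison with independent Poisson variables. The law of
  \<open>L h\<close> on the event \<open>N h = i\<close> comes from comparing Fourier coefficients
  in the frequency of \<open>N\<close>. Both are statements at fixed times; they become statements
  about paths through rational times and right-continuity. Two or more jumps of \<open>N\<close>
  within \<open>h\<close> have probability of order \<open>h^2\<close>, so after division by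
  \<open>h\<close> only the terms for zero and one jump survive. No integrability beyond a finite
  mean of \<open>L 1\<close> enters; it makes the integral converge on the half-line.\<close>

text \<open>Partial sums of a perpetuity: \<open>x i\<close> is the pair of the discount factor and the payment of
  step \<open>i\<close>.\<close>

definition perp :: "(nat \<Rightarrow> real \<times> real) \<Rightarrow> nat \<Rightarrow> real" where
  "perp x n = (\<Sum>j<n. (\<Prod>i<j. fst (x i)) * snd (x j))"

lemma measurable_fst_borel[measurable]: "(fst :: real \<times> real \<Rightarrow> real) \<in> borel_measurable borel"
  and measurable_snd_borel[measurable]: "(snd :: real \<times> real \<Rightarrow> real) \<in> borel_measurable borel"
  by (auto intro!: borel_measurable_continuous_onI continuous_intros)

lemma perp_Suc: "perp x (Suc n) = snd (x 0) + fst (x 0) * perp (\<lambda>i. x (Suc i)) n"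
  unfolding perp_def sum.lessThan_Suc_shift
  by (simp add: prod.lessThan_Suc_shift sum_distrib_left mult_ac del: prod.lessThan_Suc)

lemma perp_cong: "(\<And>i. i < n \<Longrightarrow> x i = y i) \<Longrightarrow> perp x n = perp y n"
  unfolding perp_def by (intro sum.cong arg_cong2[where f="(*)"] prod.cong) auto

lemma measurable_perp[measurable (raw)]:
  assumes "\<And>i. i < n \<Longrightarrow> (\<lambda>\<omega>. X i \<omega>) \<in> borel_measurable M"
  shows "(\<lambda>\<omega>. perp (\<lambda>i. X i \<omega>) n) \<in> borel_measurable M"
  unfolding perp_def
  by (intro borel_measurable_sum borel_measurable_times borel_measurable_prod)
     (auto intro!: measurable_compose[OF assms] simp: borel_measurable_continuous_onI continuous_on_fst continuous_on_snd)

context prob_space begin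

text \<open>Step \<open>m\<close> is independent of the block of steps \<open>m + 1\<close> to
  \<open>m + n\<close>, so the expectation over the first step can be taken last, by Fubini.\<close>

lemma perp_char_step:
  fixes X :: "nat \<Rightarrow> 'a \<Rightarrow> real \<times> real"
  assumes ind: "\<And>n. indep_vars (\<lambda>_. borel) X {..<n}"
    and law: "\<And>i. distr M borel (X i) = P"
  shows "(CLINT \<omega>|M. iexp (z * perp (\<lambda>i. X (m + i) \<omega>) (Suc n))) =
    (CLINT x|P. iexp (z * snd x) * (CLINT \<omega>|M. iexp (z * fst x * perp (\<lambda>i. X (Suc m + i) \<omega>) n)))"
proof -
  have X[measurable]: "X i \<in> borel_measurable M" for i
    using ind[of "Suc i"] by (auto simp: indep_vars_def)
  \<comment> \<open>\<open>indep_var\<close> relates variables with a common value type; the dummy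
    second coordinate gives the scalar remainder the type of \<open>X m\<close>.\<close>
  define W where "W \<omega> = (perp (\<lambda>i. X (Suc m + i) \<omega>) n, 0::real)" for \<omega>
  have [measurable]: "W \<in> borel_measurable M" unfolding W_def by measurable
  interpret P: prob_space P unfolding law[of 0, symmetric] by (rule prob_space_distr) simp
  have [measurable_cong]: "sets P = sets borel" unfolding law[of 0, symmetric] by simp
  interpret Q: prob_space "distr M borel W" by (rule prob_space_distr) simp
  interpret PQ: pair_prob_space P "distr M borel W" ..
  let ?A = "{m}" and ?B = "{Suc m..m + n}"
  have iv: "indep_var (PiM ?A (\<lambda>_. borel)) (\<lambda>\<omega>. restrict (\<lambda>i. X i \<omega>) ?A)
              (PiM ?B (\<lambda>_. borel)) (\<lambda>\<omega>. restrict (\<lambda>i. X i \<omega>) ?B)"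
    by (rule indep_var_restrict[OF ind[of "Suc (m + n)"]]) auto
  have "indep_var borel ((\<lambda>f. f m) \<circ> (\<lambda>\<omega>. restrict (\<lambda>i. X i \<omega>) ?A))
          borel ((\<lambda>f. (perp (\<lambda>i. f (Suc m + i)) n, 0)) \<circ> (\<lambda>\<omega>. restrict (\<lambda>i. X i \<omega>) ?B))"
    by (intro indep_var_compose[OF iv]) (auto intro!: measurable_perp measurable_component_singleton)
  moreover have "(\<lambda>f. f m) \<circ> (\<lambda>\<omega>. restrict (\<lambda>i. X i \<omega>) ?A) = X m"
    by auto
  moreover have "(\<lambda>f. (perp (\<lambda>i. f (Suc m + i)) n, 0)) \<circ> (\<lambda>\<omega>. restrict (\<lambda>i. X i \<omega>) ?B) = W"
    by (auto simp: W_def fun_eq_iff intro!: perp_cong)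
  ultimately have "indep_var borel (X m) borel W" by simp
  then have joint: "distr M (borel \<Otimes>\<^sub>M borel) (\<lambda>\<omega>. (X m \<omega>, W \<omega>)) = P \<Otimes>\<^sub>M distr M borel W"
    by (simp add: indep_var_distribution_eq law)
  have "(CLINT \<omega>|M. iexp (z * perp (\<lambda>i. X (m + i) \<omega>) (Suc n))) =
      (CLINT \<omega>|M. (\<lambda>p. iexp (z * (snd (fst p) + fst (fst p) * fst (snd p)))) (X m \<omega>, W \<omega>))"
    by (simp add: perp_Suc W_def)
  also have "\<dots> = (CLINT p|distr M (borel \<Otimes>\<^sub>M borel) (\<lambda>\<omega>. (X m \<omega>, W \<omega>)). (\<lambda>p. iexp (z * (snd (fst p) + fst (fst p) * fst (snd p)))) p)"
    by (subst integral_distr) auto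
  also have "\<dots> = (CLINT x|P. CLINT y|distr M borel W. iexp (z * (snd x + fst x * fst y)))"
    unfolding joint
    by (subst PQ.integral_fst'[symmetric])
       (auto intro!: PQ.integrable_const_bound[of _ 1])
  also have "\<dots> = (CLINT x|P. iexp (z * snd x) * (CLINT \<omega>|M. iexp (z * fst x * fst (W \<omega>))))"
  proof (rule Bochner_Integration.integral_cong[OF refl])
    fix x :: "real \<times> real"
    have "(CLINT y|distr M borel W. iexp (z * (snd x + fst x * fst y))) = (CLINT \<omega>|M. iexp (z * (snd x + fst x * fst (W \<omega>))))"
      by (subst integral_distr) auto
    also have "\<dots> = (CLINT \<omega>|M. iexp (z * snd x) * iexp (z * fst x * fst (W \<omega>)))"
      by (simp add: exp_add[symmetric] algebra_simps)
    finally show "(CLINT y|distr M borel W. iexp (z * (snd x + fst x * fst y))) = iexp (z * snd x) * (CLINT \<omega>|M. iexp (z * fst x * fst (W \<omega>)))"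
      by simp
  qed
  finally show ?thesis by (simp add: W_def)
qed

text \<open>The one-step recursion involves the starting index only through the shorter sum, so
  induction on the length, with the index arbitrary, removes it.\<close>

lemma perp_char_shift:
  fixes X :: "nat \<Rightarrow> 'a \<Rightarrow> real \<times> real"
  assumes ind: "\<And>n. indep_vars (\<lambda>_. borel) X {..<n}"
    and law: "\<And>i. distr M borel (X i) = P"
  shows "(CLINT \<omega>|M. iexp (z * perp (\<lambda>i. X (m + i) \<omega>) n)) = (CLINT \<omega>|M. iexp (z * perp (\<lambda>i. X i \<omega>) n))"
proof (induction n arbitrary: m z)
  case 0
  show ?case by (simp add: perp_def)
next
  case (Suc n)
  have "(CLINT \<omega>|M. iexp (z * perp (\<lambda>i. X (m + i) \<omega>) (Suc n))) =
      (CLINT x|P. iexp (z * snd x) * (CLINT \<omega>|M. iexp (z * fst x * perp (\<lambda>i. X i \<omega>) n)))" for m z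
    unfolding perp_char_step[OF assms] Suc.IH ..
  from this[of z m] this[of z 0] show ?case by simp
qed

text \<open>The finite recursion passes to the limit by dominated convergence, once under
  \<open>M\<close> and once under the step law \<open>P\<close>; all integrands have norm at most
  1.\<close>

lemma perp_limit_char:
  fixes X :: "nat \<Rightarrow> 'a \<Rightarrow> real \<times> real"
  assumes ind: "\<And>n. indep_vars (\<lambda>_. borel) X {..<n}"
    and law: "\<And>i. distr M borel (X i) = P"
    and [measurable]: "W \<in> borel_measurable M"
    and lim: "AE \<omega> in M. (\<lambda>n. perp (\<lambda>i. X i \<omega>) n) \<longlonglongrightarrow> W \<omega>"
  shows "(CLINT \<omega>|M. iexp (z * W \<omega>)) =
    (CLINT x|P. iexp (z * snd x) * (CLINT \<omega>|M. iexp (z * fst x * W \<omega>)))"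
proof -
  have X[measurable]: "X i \<in> borel_measurable M" for i
    using ind[of "Suc i"] by (auto simp: indep_vars_def)
  interpret P: prob_space P unfolding law[of 0, symmetric] by (rule prob_space_distr) simp
  have [measurable_cong]: "sets P = sets borel" unfolding law[of 0, symmetric] by simp
  define F where "F n y = (CLINT \<omega>|M. iexp (y * perp (\<lambda>i. X i \<omega>) n))" for n y
  define G where "G y = (CLINT \<omega>|M. iexp (y * W \<omega>))" for y
  have conv: "(\<lambda>n. F n y) \<longlonglongrightarrow> G y" for y
    unfolding F_def G_def
  proof (rule integral_dominated_convergence[where w="\<lambda>_. 1"])
    show "AE \<omega> in M. (\<lambda>n. iexp (y * perp (\<lambda>i. X i \<omega>) n)) \<longlonglongrightarrow> iexp (y * W \<omega>)"
      using lim by eventually_elim (intro tendsto_intros)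
  qed auto
  have bnd: "norm (F n y) \<le> 1" for y n
    unfolding F_def
    using integral_norm_bound[of M "\<lambda>\<omega>. iexp (y * perp (\<lambda>i. X i \<omega>) n)"] by (simp add: prob_space)
  have meas: "(\<lambda>y. (CLINT \<omega>|M. iexp (y * V \<omega>))) \<in> borel_measurable borel"
    if [measurable]: "V \<in> borel_measurable M" for V
  proof -
    interpret V: real_distribution "distr M borel V" by (rule real_distribution_distr) simp
    have "char (distr M borel V) y = (CLINT \<omega>|M. iexp (y * V \<omega>))" for y
      unfolding char_def by (subst integral_distr) auto
    then show ?thesis using V.char_measurable by presburger
  qed
  have [measurable]: "F n \<in> borel_measurable borel" "G \<in> borel_measurable borel" for n
    unfolding F_def G_def by (auto intro!: meas)
  have "(\<lambda>n. CLINT x|P. iexp (z * snd x) * F n (z * fst x)) \<longlonglongrightarrow> (CLINT x|P. iexp (z * snd x) * G (z * fst x))"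
  proof (rule integral_dominated_convergence[where w="\<lambda>_. 1"])
    show "AE x in P. (\<lambda>n. iexp (z * snd x) * F n (z * fst x)) \<longlonglongrightarrow> iexp (z * snd x) * G (z * fst x)"
      by (intro AE_I2 tendsto_mult tendsto_const conv)
  qed (auto simp: norm_mult bnd)
  moreover have "(CLINT x|P. iexp (z * snd x) * F n (z * fst x)) = F (Suc n) z" for n
  proof -
    have sh: "(CLINT \<omega>|M. iexp (y * perp (\<lambda>i. X (Suc 0 + i) \<omega>) n)) = F n y" for y
      unfolding F_def by (rule perp_char_shift[OF ind law])
    show ?thesis
      using perp_char_step[OF ind law, of z 0 n] unfolding sh by (simp add: F_def)
  qed
  ultimately have "(CLINT x|P. iexp (z * snd x) * G (z * fst x)) = G z"
    using LIMSEQ_unique LIMSEQ_Suc[OF conv[of z]] by simp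
  then show ?thesis by (simp add: G_def)
qed

end

section \<open>Step paths and their Stieltjes integrals\<close>

text \<open>For natural \<open>x\<close> and \<open>\<kappa> = 1 / c\<close> this is \<open>c powr (- x)\<close>; unlike \<open>powr\<close> it also covers
  \<open>\<kappa> = 0\<close>, where it becomes the indicator of \<open>x < 1\<close>.\<close>

definition wt :: "real \<Rightarrow> real \<Rightarrow> real" where
  "wt \<kappa> x = \<kappa> ^ nat \<lfloor>x\<rfloor>"

lemma wt_of_nat[simp]: "wt \<kappa> (real i) = \<kappa> ^ i"
  by (simp add: wt_def)

lemma measurable_wt[measurable]: "wt \<kappa> \<in> borel_measurable borel"
  unfolding wt_def[abs_def] by measurable

lemma wt_add: "x \<in> \<nat> \<Longrightarrow> y \<in> \<nat> \<Longrightarrow> wt \<kappa> (x + y) = wt \<kappa> x * wt \<kappa> y"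
  by (auto elim!: Nats_cases simp: power_add simp flip: of_nat_add)

text \<open>The accumulated discount depends only on the current value of \<open>N\<close>.
  Integrality of the increments is essential, because \<open>wt\<close> is multiplicative on
  naturals only.\<close>

lemma prod_wt_telescope:
  assumes "a 0 = 0" and "\<And>j. a (Suc j) - a j \<in> \<nat>"
  shows "(\<Prod>j<i. wt \<kappa> (a (Suc j) - a j)) = wt \<kappa> (a i)"
proof -
  have "a i \<in> \<nat> \<and> (\<Prod>j<i. wt \<kappa> (a (Suc j) - a j)) = wt \<kappa> (a i)"
  proof (induction i)
    case 0
    show ?case using assms(1) by (simp add: wt_def)
  next
    case (Suc i)
    have "a i + (a (Suc i) - a i) \<in> \<nat>" using Suc assms(2) by (intro Nats_add) auto
    moreover have "wt \<kappa> (a i + (a (Suc i) - a i)) = wt \<kappa> (a i) * wt \<kappa> (a (Suc i) - a i)"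
      using Suc assms(2) by (intro wt_add) auto
    ultimately show ?case using Suc by simp
  qed
  then show ?thesis by simp
qed

lemma wt_bounds:
  assumes "0 \<le> \<kappa>" "\<kappa> < 1"
  shows "0 \<le> wt \<kappa> x" "wt \<kappa> x \<le> 1"
  using assms by (auto simp: wt_def power_le_one)

text \<open>Collects what holds for almost every path, so that the integral can be treated without
  probability. \<open>summable_unit\<close> supplies the convergence: the unit grid yields an
  integrable majorant for all finer grids and for the integrand itself.\<close>

locale step_path =
  fixes n l :: "real \<Rightarrow> real" and \<kappa> :: real
  assumes n_0: "n 0 = 0" and l_0: "l 0 = 0"
    and n_mono: "0 \<le> s \<Longrightarrow> s \<le> t \<Longrightarrow> n s \<le> n t"
    and l_mono: "0 \<le> s \<Longrightarrow> s \<le> t \<Longrightarrow> l s \<le> l t"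
    and n_nat: "0 \<le> t \<Longrightarrow> \<exists>i::nat. n t = real i"
    and n_right: "0 \<le> t \<Longrightarrow> (n \<longlongrightarrow> n t) (at_right t)"
    and l_right: "0 \<le> t \<Longrightarrow> (l \<longlongrightarrow> l t) (at_right t)"
    and \<kappa>: "0 \<le> \<kappa>" "\<kappa> < 1"
    and summable_unit: "summable (\<lambda>i. wt \<kappa> (n (real i)) * (l (real (Suc i)) - l (real i)))"
begin

text \<open>Before \<open>s\<close> the path takes natural values bounded by \<open>n s\<close>,
  hence finitely many. From a time at which the largest of them is attained, monotonicity freezes
  the path until \<open>s\<close>.\<close>

lemma left_limit_const:
  assumes "s > 0"
  obtains a where "0 \<le> a" "a < s" "\<And>r. a \<le> r \<Longrightarrow> r < s \<Longrightarrow> n r = left_limit n s"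
proof -
  define A where "A = {i::nat. \<exists>r. 0 \<le> r \<and> r < s \<and> n r = real i}"
  have fin: "finite A"
  proof (rule finite_subset)
    show "A \<subseteq> {..nat \<lfloor>n s\<rfloor>}"
    proof
      fix i assume "i \<in> A"
      then obtain r where "0 \<le> r" "r < s" "n r = real i" by (auto simp: A_def)
      then have "real i \<le> n s" using n_mono[of r s] by simp
      then show "i \<in> {..nat \<lfloor>n s\<rfloor>}" by (simp add: le_nat_floor)
    qed
  qed simp
  have "0 \<in> A" using assms n_0 by (auto simp: A_def intro!: exI[of _ 0])
  then have "Max A \<in> A" using fin by (intro Max_in) auto
  then obtain a where a: "0 \<le> a" "a < s" "n a = real (Max A)" by (auto simp: A_def)
  have const: "n r = n a" if "a \<le> r" "r < s" for r
  proof -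
    have "0 \<le> r" using a that by simp
    then obtain i where i: "n r = real i" using n_nat[of r] by auto
    then have "i \<in> A" using a that by (auto simp: A_def intro!: exI[of _ r])
    then have "n r \<le> n a" using a i fin by simp
    then show ?thesis using n_mono[of a r] a that by simp
  qed
  have "eventually (\<lambda>r. n r = n a) (at_left s)"
    unfolding eventually_at_left_field using a(2) by (intro exI[of _ a] conjI allI impI const) auto
  then have "(n \<longlongrightarrow> n a) (at_left s)" by (rule tendsto_eventually)
  then have "left_limit n s = n a"
    unfolding left_limit_def by (intro tendsto_Lim) auto
  with a const that show ?thesis by metis
qed

lemma left_limit_nat: "s > 0 \<Longrightarrow> \<exists>i::nat. left_limit n s = real i"
  by (metis left_limit_const n_nat order.refl)

lemma wt_antimono:
  assumes "0 \<le> s" "s \<le> t"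
  shows "wt \<kappa> (n t) \<le> wt \<kappa> (n s)"
  using n_mono[OF assms] \<kappa> unfolding wt_def
  by (intro power_decreasing nat_mono floor_mono) auto

section \<open>The Stieltjes measure of a path and its grid sums\<close>

abbreviation \<nu> :: "real measure" where
  "\<nu> \<equiv> interval_measure (\<lambda>s. l (max s 0))"

lemma integrator_mono: "x \<le> y \<Longrightarrow> l (max x 0) \<le> l (max y 0)"
  by (intro l_mono) auto

lemma integrator_right_cont: "continuous (at_right a) (\<lambda>s. l (max s 0))"
proof (cases "a \<ge> 0")
  case True
  have "((\<lambda>s. l (max s 0)) \<longlongrightarrow> l a) (at_right a)"
    by (rule Lim_transform_eventually[OF l_right[OF True]])
       (use True in \<open>auto simp: eventually_at_right_less intro: eventually_mono[OF eventually_at_right_less[of a]]\<close>)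
  then show ?thesis using True by (simp add: continuous_within)
next
  case False
  have "((\<lambda>s. l (max s 0)) \<longlongrightarrow> l 0) (at_right a)"
    using False by (intro tendsto_eventually) (auto simp: eventually_at_right_field intro!: exI[of _ 0])
  then show ?thesis using False by (simp add: continuous_within)
qed

lemma emeasure_Ioc: "0 \<le> a \<Longrightarrow> a \<le> b \<Longrightarrow> emeasure \<nu> {a<..b} = ennreal (l b - l a)"
  by (subst emeasure_interval_measure_Ioc[OF _ integrator_mono integrator_right_cont]) auto

lemma measure_Ioc: "0 \<le> a \<Longrightarrow> a \<le> b \<Longrightarrow> measure \<nu> {a<..b} = l b - l a"
  using l_mono[of a b] by (simp add: measure_def emeasure_Ioc)

text \<open>The left-endpoint step approximation of the integrand on the grid of mesh \<open>1 / m\<close>. The one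
  of mesh 1 dominates all others, which gives dominated convergence on the whole half-line.\<close>

definition f :: "nat \<Rightarrow> real \<Rightarrow> real" where
  "f m s = wt \<kappa> (n (real (nat \<lceil>s * real m\<rceil> - 1) / real m))"

lemma measurable_f[measurable]: "f m \<in> borel_measurable borel"
proof -
  have "(\<lambda>s. (\<lambda>j. wt \<kappa> (n (real (j - 1) / real m))) (nat \<lceil>s * real m\<rceil>)) \<in> borel_measurable borel"
    by measurable
  then show ?thesis unfolding f_def[abs_def] .
qed

lemma f_bounds: "0 \<le> f m s" "f m s \<le> 1"
  by (auto simp: f_def wt_bounds \<kappa>)

text \<open>Rounding up and subtracting one selects the cell, open on the left and closed on the
  right, that contains \<open>s\<close>. These are the intervals on which
  \<open>interval_measure\<close> is explicit, and the sampling point lies strictly before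
  \<open>s\<close>.\<close>

lemma f_eq:
  assumes "m > 0" "real j / real m < s" "s \<le> real (Suc j) / real m"
  shows "f m s = wt \<kappa> (n (real j / real m))"
proof -
  have "\<lceil>s * real m\<rceil> = int (Suc j)"
    using assms by (intro ceiling_unique) (auto simp: field_simps)
  then show ?thesis by (simp add: f_def)
qed

lemma grid_left:
  assumes "m > 0" "s > 0"
  shows "real (nat \<lceil>s * real m\<rceil> - 1) / real m < s" "s - 1 / real m \<le> real (nat \<lceil>s * real m\<rceil> - 1) / real m"
proof -
  have pos: "s * real m > 0" using assms by simp
  then have "nat \<lceil>s * real m\<rceil> \<ge> 1" by linarith
  then have "real (nat \<lceil>s * real m\<rceil> - 1) = real (nat \<lceil>s * real m\<rceil>) - 1"
    by (rule of_nat_diff[of 1, unfolded of_nat_1])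
  also have "\<dots> = of_int \<lceil>s * real m\<rceil> - 1" using pos by simp
  finally have "real (nat \<lceil>s * real m\<rceil> - 1) = of_int \<lceil>s * real m\<rceil> - 1" .
  moreover have "of_int \<lceil>s * real m\<rceil> - 1 < s * real m" "s * real m \<le> of_int \<lceil>s * real m\<rceil>"
    by linarith+
  ultimately show "real (nat \<lceil>s * real m\<rceil> - 1) / real m < s" "s - 1 / real m \<le> real (nat \<lceil>s * real m\<rceil> - 1) / real m"
    using assms by (simp_all add: field_simps)
qed

text \<open>The sampling point is strictly left of \<open>s\<close> and within \<open>1 / m\<close>
  of it, so it eventually falls into the stretch where \<open>n\<close> already equals its left
  limit.\<close>

lemma f_tendsto:
  assumes "s > 0"
  shows "(\<lambda>m. f m s) \<longlonglongrightarrow> wt \<kappa> (left_limit n s)"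
proof -
  obtain a where a: "0 \<le> a" "a < s" "\<And>r. a \<le> r \<Longrightarrow> r < s \<Longrightarrow> n r = left_limit n s"
    using left_limit_const[OF assms] by blast
  have "eventually (\<lambda>m. 1 / real m < s - a) sequentially"
    using a(2) order_tendstoD(2)[OF lim_1_over_n, of "s - a"] by simp
  then have "eventually (\<lambda>m. f m s = wt \<kappa> (left_limit n s)) sequentially"
    using eventually_gt_at_top[of 0]
  proof eventually_elim
    case (elim m)
    then show ?case
      using grid_left[of m s] assms by (simp add: f_def a(3))
  qed
  then show ?thesis by (rule tendsto_eventually)
qed

text \<open>Integers belong to every grid of mesh \<open>1 / m\<close>, so the finer left endpoint
  is never before the coarser one, and the weight decreases in time.\<close>

lemma f_le_f1:
  assumes "m > 0" "s > 0"
  shows "f m s \<le> f 1 s"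
proof -
  define i where "i = nat \<lceil>s\<rceil> - 1"
  have "real i < s" using grid_left(1)[of 1 s] assms by (simp add: i_def)
  then have "real i * real m < s * real m" using assms by simp
  then have "int (i * m) < \<lceil>s * real m\<rceil>" by (simp add: less_ceiling_iff)
  then have "i * m \<le> nat \<lceil>s * real m\<rceil> - 1" by linarith
  then have "real i * real m \<le> real (nat \<lceil>s * real m\<rceil> - 1)"
    by (metis of_nat_le_iff of_nat_mult)
  then have "real i \<le> real (nat \<lceil>s * real m\<rceil> - 1) / real m"
    using assms by (simp add: field_simps)
  then show ?thesis
    unfolding f_def using wt_antimono[of "real i"] by (simp add: i_def)
qed

lemma set_integrable_Ioc:
  assumes [measurable]: "g \<in> borel_measurable borel" and "\<And>s. norm (g s) \<le> 1" "0 \<le> a"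
  shows "set_integrable \<nu> {a<..b} (g :: real \<Rightarrow> real)"
proof (cases "a \<le> b")
  case True
  show ?thesis
    unfolding set_integrable_def
  proof (rule Bochner_Integration.integrable_bound[of _ "indicator {a<..b} :: real \<Rightarrow> real"])
    show "integrable \<nu> (indicator {a<..b} :: real \<Rightarrow> real)"
      using emeasure_Ioc[OF assms(3) True] by (intro integrable_real_indicator) auto
    show "AE s in \<nu>. norm (indicator {a<..b} s *\<^sub>R g s) \<le> norm (indicator {a<..b} s :: real)"
      using assms(2) by (intro AE_I2) (auto simp: indicator_def)
  qed measurable
qed (simp add: set_integrable_def)

lemma set_integral_f:
  assumes "m > 0"
  shows "(LINT s:{0<..real K / real m}|\<nu>. f m s) =
    (\<Sum>j<K. wt \<kappa> (n (real j / real m)) * (l (real (Suc j) / real m) - l (real j / real m)))"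
proof (induction K)
  case 0
  show ?case by (simp add: set_lebesgue_integral_def)
next
  case (Suc K)
  have le: "real K / real m \<le> real (Suc K) / real m" using assms by (simp add: divide_right_mono)
  have "{0<..real (Suc K) / real m} = {0<..real K / real m} \<union> {real K / real m<..real (Suc K) / real m}"
    using le by (auto intro: order_trans) (meson divide_nonneg_nonneg le_less_trans of_nat_0_le_iff)
  then have "(LINT s:{0<..real (Suc K) / real m}|\<nu>. f m s) =
      (LINT s:{0<..real K / real m}|\<nu>. f m s) + (LINT s:{real K / real m<..real (Suc K) / real m}|\<nu>. f m s)"
    by (simp only:) (rule set_integral_Un, auto intro!: set_integrable_Ioc simp: f_bounds)
  moreover have "(LINT s:{real K / real m<..real (Suc K) / real m}|\<nu>. f m s) =
      (LINT s:{real K / real m<..real (Suc K) / real m}|\<nu>. wt \<kappa> (n (real K / real m)))"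
    by (rule set_lebesgue_integral_cong) (auto intro!: f_eq assms)
  moreover have "\<dots> = wt \<kappa> (n (real K / real m)) * (l (real (Suc K) / real m) - l (real K / real m))"
    using le emeasure_Ioc[of "real K / real m" "real (Suc K) / real m"]
    by (simp add: set_lebesgue_integral_def measure_Ioc mult.commute)
  ultimately show ?case using Suc by simp
qed

text \<open>Monotone convergence: the integrals over \<open>{0<..real K}\<close> are the partial
  sums of the series in \<open>summable_unit\<close>.\<close>

lemma set_integrable_f1: "set_integrable \<nu> {0<..} (f 1)"
  unfolding set_integrable_def real_scaleR_def
proof (rule integrable_monotone_convergence[where f="\<lambda>K s. indicator {0<..real K} s * f 1 s"])
  show "integrable \<nu> (\<lambda>s. indicator {0<..real K} s * f 1 s)" for K
    using set_integrable_Ioc[of "f 1" 0 "real K"] by (simp add: set_integrable_def f_bounds)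
  show "AE s in \<nu>. mono (\<lambda>K. indicator {0<..real K} s * f 1 s)"
    by (auto simp: mono_def indicator_def f_bounds)
  show "AE s in \<nu>. (\<lambda>K. indicator {0<..real K} s * f 1 s) \<longlonglongrightarrow> indicator {0<..} s * f 1 s"
  proof (rule AE_I2)
    fix s
    have "eventually (\<lambda>K. s \<le> real K) sequentially"
      using filterlim_real_sequentially by (simp add: filterlim_at_top)
    then show "(\<lambda>K. indicator {0<..real K} s * f 1 s) \<longlonglongrightarrow> indicator {0<..} s * f 1 s"
      by (intro tendsto_eventually) (auto elim!: eventually_mono simp: indicator_def)
  qed
  have "(\<integral>s. indicator {0<..real K} s * f 1 s \<partial>\<nu>) = (\<Sum>i<K. wt \<kappa> (n (real i)) * (l (real (Suc i)) - l (real i)))" for K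
    using set_integral_f[of 1 K] by (simp add: set_lebesgue_integral_def)
  then show "(\<lambda>K. \<integral>s. indicator {0<..real K} s * f 1 s \<partial>\<nu>) \<longlonglongrightarrow> (\<Sum>i. wt \<kappa> (n (real i)) * (l (real (Suc i)) - l (real i)))"
    using summable_LIMSEQ[OF summable_unit] by simp
qed measurable

definition total where "total = (LINT s:{0<..}|\<nu>. wt \<kappa> (left_limit n s))"
definition grid_total where "grid_total m = (LINT s:{0<..}|\<nu>. f m s)"

text \<open>The left limits inherit measurability from the step functions converging to them; the
  indicator discards times at which \<open>left_limit\<close> is uncontrolled.\<close>

lemma measurable_left_limit: "(\<lambda>s. indicator {0<..} s * wt \<kappa> (left_limit n s)) \<in> borel_measurable borel"
  by (rule borel_measurable_LIMSEQ_metric[where f="\<lambda>m s. indicator {0<..} s * f m s"])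
     (auto simp: indicator_def f_tendsto)

lemma measurable_left_limit_\<nu>: "(\<lambda>s. indicator {0<..} s * wt \<kappa> (left_limit n s)) \<in> borel_measurable \<nu>"
  by (subst measurable_cong_sets[OF sets_interval_measure refl]) (rule measurable_left_limit)

lemma grid_total:
  assumes "m > 0"
  shows "(\<lambda>K. \<Sum>j<K. wt \<kappa> (n (real j / real m)) * (l (real (Suc j) / real m) - l (real j / real m))) \<longlonglongrightarrow> grid_total m"
  unfolding set_integral_f[OF assms, symmetric] grid_total_def set_lebesgue_integral_def
proof (rule integral_dominated_convergence[where w="\<lambda>s. indicator {0<..} s *\<^sub>R f 1 s"])
  show "integrable \<nu> (\<lambda>s. indicator {0<..} s *\<^sub>R f 1 s)"
    using set_integrable_f1 by (simp add: set_integrable_def)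
  show "AE s in \<nu>. (\<lambda>K. indicator {0<..real K / real m} s *\<^sub>R f m s) \<longlonglongrightarrow> indicator {0<..} s *\<^sub>R f m s"
  proof (rule AE_I2)
    fix s
    have "eventually (\<lambda>K. s * real m \<le> real K) sequentially"
      using filterlim_real_sequentially by (simp add: filterlim_at_top)
    then have "eventually (\<lambda>K. s \<le> real K / real m) sequentially"
      using assms by (simp add: field_simps)
    then show "(\<lambda>K. indicator {0<..real K / real m} s *\<^sub>R f m s) \<longlonglongrightarrow> indicator {0<..} s *\<^sub>R f m s"
      by (intro tendsto_eventually) (auto elim!: eventually_mono simp: indicator_def)
  qed
  show "AE s in \<nu>. norm (indicator {0<..real K / real m} s *\<^sub>R f m s) \<le> indicator {0<..} s *\<^sub>R f 1 s" for K
    using f_le_f1[OF assms] by (intro AE_I2) (auto simp: indicator_def f_bounds)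
qed measurable

lemma grid_total_tendsto: "grid_total \<longlonglongrightarrow> total"
proof -
  have "(\<lambda>m. grid_total (Suc m)) \<longlonglongrightarrow> total"
    unfolding grid_total_def total_def set_lebesgue_integral_def real_scaleR_def
  proof (rule integral_dominated_convergence[where w="\<lambda>s. indicator {0<..} s * f 1 s"])
    show "integrable \<nu> (\<lambda>s. indicator {0<..} s * f 1 s)"
      using set_integrable_f1 by (simp add: set_integrable_def)
    show "AE s in \<nu>. (\<lambda>m. indicator {0<..} s * f (Suc m) s) \<longlonglongrightarrow> indicator {0<..} s * wt \<kappa> (left_limit n s)"
      using LIMSEQ_Suc[OF f_tendsto] by (auto simp: indicator_def)
    show "AE s in \<nu>. norm (indicator {0<..} s * f (Suc m) s) \<le> indicator {0<..} s * f 1 s" for m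
      using f_le_f1[of "Suc m"] by (intro AE_I2) (auto simp: indicator_def f_bounds)
  qed (use measurable_left_limit in measurable)
  then show ?thesis by (rule LIMSEQ_imp_Suc)
qed

lemma integral_at_top: "((\<lambda>t. LINT s:{0<..t}|\<nu>. wt \<kappa> (left_limit n s)) \<longlongrightarrow> total) at_top"
  unfolding total_def set_lebesgue_integral_def real_scaleR_def
proof (rule integral_dominated_convergence_at_top[where w="\<lambda>s. indicator {0<..} s * f 1 s"])
  note [measurable] = measurable_left_limit
  have "(\<lambda>s. indicator {..t} s * (indicator {0<..} s * wt \<kappa> (left_limit n s))) \<in> borel_measurable \<nu>" for t :: real
    by measurable
  then show "(\<lambda>s. indicator {0<..t} s * wt \<kappa> (left_limit n s)) \<in> borel_measurable \<nu>" for t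
    by (rule measurable_cong[THEN iffD1, rotated]) (auto simp: indicator_def)
  show "integrable \<nu> (\<lambda>s. indicator {0<..} s * f 1 s)"
    using set_integrable_f1 by (simp add: set_integrable_def)
  show "AE s in \<nu>. ((\<lambda>t. indicator {0<..t} s * wt \<kappa> (left_limit n s)) \<longlongrightarrow> indicator {0<..} s * wt \<kappa> (left_limit n s)) at_top"
  proof (rule AE_I2)
    fix s
    show "((\<lambda>t. indicator {0<..t} s * wt \<kappa> (left_limit n s)) \<longlongrightarrow> indicator {0<..} s * wt \<kappa> (left_limit n s)) at_top"
      by (intro tendsto_eventually eventually_mono[OF eventually_ge_at_top[of s]]) (auto simp: indicator_def)
  qed
  \<comment> \<open>The majorant of the step approximations also bounds their pointwise
    limit.\<close>
  have "wt \<kappa> (left_limit n s) \<le> f 1 s" if "s > 0" for s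
    by (rule tendsto_upperbound[OF f_tendsto[OF that]])
       (use f_le_f1[OF _ that] in \<open>auto intro: eventually_mono[OF eventually_gt_at_top[of 0]]\<close>)
  then show "\<forall>\<^sub>F t in at_top. AE s in \<nu>. norm (indicator {0<..t} s * wt \<kappa> (left_limit n s)) \<le> indicator {0<..} s * f 1 s"
    by (intro always_eventually allI AE_I2) (auto simp: indicator_def wt_bounds \<kappa> f_bounds)
qed (rule measurable_left_limit_\<nu>)

lemma improper_exp_integral_eq:
  assumes "c > 1" "\<kappa> = inverse c"
  shows "improper_exp_integral c n l = total"
proof -
  have "exp_integral c n l t = (LINT s:{0<..t}|\<nu>. wt \<kappa> (left_limit n s))" for t
    unfolding exp_integral_def
  proof (rule set_lebesgue_integral_cong)
    show "\<forall>s. s \<in> {0<..t} \<longrightarrow> c powr - left_limit n s = wt \<kappa> (left_limit n s)"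
    proof safe
      fix s assume "s \<in> {0<..t}"
      then obtain i :: nat where i: "left_limit n s = real i" using left_limit_nat by auto
      show "c powr - left_limit n s = wt \<kappa> (left_limit n s)"
        unfolding i wt_of_nat using assms by (simp add: powr_minus powr_realpow power_inverse)
    qed
  qed simp
  then have "exp_integral c n l = (\<lambda>t. LINT s:{0<..t}|\<nu>. wt \<kappa> (left_limit n s))" by (rule ext)
  then show ?thesis
    unfolding improper_exp_integral_def using tendsto_Lim[OF _ integral_at_top] by simp
qed

text \<open>For \<open>\<kappa> = 0\<close> the weight is 1 as long as the left limit is 0 and
  vanishes once it is at least 1, so \<open>total\<close> is the mass of \<open>{0<..T}\<close>. The
  payment made at \<open>T\<close> itself counts, since the left limit there is still 0.\<close>

lemma value_at_first_jump:
  assumes "\<kappa> = 0" and ex: "\<exists>t\<ge>0. n t \<noteq> 0"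
  shows "l (first_jump_time n) = total"
proof -
  define T where "T = Inf {t. 0 \<le> t \<and> n t \<noteq> 0}"
  have bdd: "bdd_below {t. 0 \<le> t \<and> n t \<noteq> 0}" by (auto intro!: bdd_belowI)
  have T0: "T \<ge> 0" unfolding T_def using ex by (intro cInf_greatest) auto
  have before: "n t = 0" if "0 \<le> t" "t < T" for t
  proof (rule ccontr)
    assume "n t \<noteq> 0"
    then have "T \<le> t" unfolding T_def using that by (intro cInf_lower bdd) auto
    with that show False by simp
  qed
  have after: "n t \<ge> 1" if tT: "T < t" for t
  proof -
    obtain s where s: "0 \<le> s" "n s \<noteq> 0" "s < t"
      using cInf_lessD[of "{t. 0 \<le> t \<and> n t \<noteq> 0}" t] ex tT unfolding T_def by auto
    then obtain i :: nat where "n s = real i" using n_nat by auto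
    then show ?thesis using s n_mono[of s t] by simp
  qed
  \<comment> \<open>Right-continuity carries the bound from times after \<open>T\<close> to
    \<open>T\<close> itself, so the infimum is attained, and \<open>n 0 = 0\<close> then excludes
    \<open>T = 0\<close>.\<close>
  have "n T \<ge> 1"
    by (rule tendsto_lowerbound[OF n_right[OF T0]])
       (auto intro!: after eventually_mono[OF eventually_at_right_less])
  then have Tpos: "T > 0" using n_0 T0 by (cases "T = 0") auto
  have ll_before: "left_limit n t = 0" if t: "0 < t" "t \<le> T" for t
  proof -
    obtain a where a: "0 \<le> a" "a < t" "\<And>r. a \<le> r \<Longrightarrow> r < t \<Longrightarrow> n r = left_limit n t"
      using left_limit_const[OF t(1)] by blast
    then show ?thesis using a(3)[of a] before[of a] t by simp
  qed
  have ll_after: "left_limit n t \<ge> 1" if t: "T < t" for t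
  proof -
    have "t > 0" using t T0 by simp
    then obtain a where a: "0 \<le> a" "a < t" "\<And>r. a \<le> r \<Longrightarrow> r < t \<Longrightarrow> n r = left_limit n t"
      using left_limit_const by blast
    \<comment> \<open>The midpoint pushes \<open>r\<close> past \<open>T\<close>; the maximum keeps
      it on the stretch where \<open>n\<close> equals its left limit at \<open>t\<close>.\<close>
    define r where "r = max a ((T + t) / 2)"
    have "a \<le> r" "r < t" "T < r" using a t by (auto simp: r_def max_def)
    then show ?thesis using a(3)[of r] after[of r] by simp
  qed
  have "first_jump_time n = T"
    unfolding first_jump_time_def
  proof (rule cInf_eq_minimum)
    show "T \<in> {t. 0 < t \<and> n t \<noteq> left_limit n t}"
      using Tpos \<open>n T \<ge> 1\<close> ll_before[of T] by auto
    show "T \<le> t" if "t \<in> {t. 0 < t \<and> n t \<noteq> left_limit n t}" for t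
      using that before[of t] ll_before[of t] by (cases "t < T") auto
  qed
  moreover have "total = (LINT s:{0<..T}|\<nu>. 1)"
    unfolding total_def set_lebesgue_integral_def
  proof (rule Bochner_Integration.integral_cong[OF refl])
    fix s
    have "wt \<kappa> (left_limit n s) = 0" if s: "T < s"
    proof -
      have "nat \<lfloor>left_limit n s\<rfloor> \<noteq> 0" using ll_after[OF s] by (simp add: le_floor_iff)
      then show ?thesis by (simp add: wt_def assms)
    qed
    moreover have "wt \<kappa> (left_limit n s) = 1" if "0 < s" "s \<le> T"
      using ll_before[OF that] by (simp add: wt_def)
    ultimately show "indicator {0<..} s *\<^sub>R wt \<kappa> (left_limit n s) = indicator {0<..T} s *\<^sub>R 1"
      using Tpos by (auto simp: indicator_def)
  qed
  moreover have "(LINT s:{0<..T}|\<nu>. 1) = l T"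
    using Tpos emeasure_Ioc[of 0 T] by (simp add: set_lebesgue_integral_def measure_Ioc l_0)
  ultimately show ?thesis by simp
qed

text \<open>The bridge to perpetuities: the discount factors telescope to the weight at the left
  endpoint, so the grid sums are partial sums driven by increments alone.\<close>

lemma perp_grid:
  assumes "m > 0"
  shows "(\<lambda>K. perp (\<lambda>i. (wt \<kappa> (n (real (Suc i) / real m) - n (real i / real m)),
      l (real (Suc i) / real m) - l (real i / real m))) K) \<longlonglongrightarrow> grid_total m"
proof -
  have *: "(\<Prod>i<j. wt \<kappa> (n (real (Suc i) / real m) - n (real i / real m))) = wt \<kappa> (n (real j / real m))" for j
  proof (rule prod_wt_telescope)
    fix j
    have "real j / real m \<le> real (Suc j) / real m" by (simp add: divide_right_mono)
    then have le: "n (real j / real m) \<le> n (real (Suc j) / real m)" by (intro n_mono) auto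
    obtain i where i: "n (real j / real m) = real i" using n_nat[of "real j / real m"] by auto
    obtain k where k: "n (real (Suc j) / real m) = real k" using n_nat[of "real (Suc j) / real m"] by auto
    have "real k - real i = real (k - i)" using le i k by (simp add: of_nat_diff)
    then show "n (real (Suc j) / real m) - n (real j / real m) \<in> \<nat>"
      unfolding i k by (metis of_nat_in_Nats)
  qed (simp add: n_0)
  show ?thesis
    using grid_total[OF assms] unfolding perp_def fst_conv snd_conv * .
qed

end

section \<open>Poisson laws\<close>

lemma poisson_char:
  fixes a :: real
  assumes "a \<ge> 0"
  obtains P :: "nat pmf" where
    "\<And>x. (CLINT n|measure_pmf P. iexp (x * real n)) = exp (a * (iexp x - 1))"
    "integrable (measure_pmf P) real"
proof (cases "a = 0")
  case True
  show ?thesis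
    by (rule that[of "return_pmf 0"]) (auto simp: True integrable_measure_pmf_finite)
next
  case False
  with assms have a: "a > 0" by simp
  define P where "P = poisson_pmf a"
  have pmfP: "pmf P n = a ^ n / fact n * exp (-a)" for n
    using a by (simp add: P_def)
  show ?thesis
  proof (rule that[of P])
    fix x
    define g where "g n = pmf P n *\<^sub>R iexp (x * real n)" for n
    have g: "g n = exp (- of_real a) * ((of_real a * iexp x) ^ n /\<^sub>R fact n)" for n
    proof -
      have "iexp (x * real n) = iexp x ^ n"
        by (simp add: exp_of_nat_mult[symmetric] mult_ac)
      then show ?thesis
        by (simp add: g_def pmfP exp_of_real[symmetric] scaleR_conv_of_real power_mult_distrib field_simps)
    qed
    have "summable (\<lambda>n. norm (g n))"
      unfolding g using summable_norm_exp[of "of_real a * iexp x"]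
      by (simp add: norm_mult summable_mult[where c="exp (-a)"] mult.left_commute[of _ "exp (-a)"])
    then have int: "integrable (count_space UNIV) g"
      by (simp add: integrable_count_space_nat_iff)
    have "(CLINT n|measure_pmf P. iexp (x * real n)) = integral\<^sup>L (count_space UNIV) g"
      unfolding measure_pmf_eq_density g_def by (subst integral_density) auto
    moreover have "g sums integral\<^sup>L (count_space UNIV) g"
      by (rule sums_integral_count_space_nat[OF int])
    moreover have "g sums (exp (- of_real a) * exp (of_real a * iexp x))"
      unfolding g by (intro sums_mult exp_converges)
    ultimately have "(CLINT n|measure_pmf P. iexp (x * real n)) = exp (- of_real a) * exp (of_real a * iexp x)"
      using sums_unique2 by metis
    then show "(CLINT n|measure_pmf P. iexp (x * real n)) = exp (a * (iexp x - 1))"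
      by (simp add: exp_add[symmetric] algebra_simps)
  next
    have "summable (\<lambda>n. norm (pmf P n *\<^sub>R real n))"
    \<comment> \<open>After the index shift the factor \<open>Suc n\<close> cancels against the
      factorial and an exponential series remains.\<close>
    proof (subst summable_Suc_iff[symmetric])
      have "(\<lambda>n. norm (pmf P (Suc n) *\<^sub>R real (Suc n))) = (\<lambda>n. exp (-a) * a * (a ^ n /\<^sub>R fact n))"
        using a by (auto simp: pmfP fun_eq_iff divide_simps simp del: of_nat_Suc)
      then show "summable (\<lambda>n. norm (pmf P (Suc n) *\<^sub>R real (Suc n)))"
        using summable_exp[of a] by (simp add: summable_mult divide_inverse mult.commute)
    qed
    then show "integrable (measure_pmf P) real"
      unfolding measure_pmf_eq_density
      by (subst integrable_density) (auto simp: integrable_count_space_nat_iff)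
  qed
qed

text \<open>An explicit model, \<open>d1\<close> and \<open>d2\<close> times two independent Poisson
  variables, has the prescribed characteristic function. By uniqueness its law is that of
  \<open>Y\<close>, so support and integrability can be read off the model.\<close>

lemma two_poisson_law:
  fixes Y :: "'a \<Rightarrow> real" and a b d1 d2 :: real
  assumes "prob_space M" and Y[measurable]: "Y \<in> borel_measurable M"
    and ab: "a \<ge> 0" "b \<ge> 0"
    and ch: "\<And>z. (CLINT \<omega>|M. iexp (z * Y \<omega>)) = exp (a * (iexp (z * d1) - 1) + b * (iexp (z * d2) - 1))"
  shows "AE \<omega> in M. \<exists>m n::nat. Y \<omega> = real m * d1 + real n * d2"
    and "integrable M Y"
proof -
  interpret M: prob_space M by fact
  obtain P where P: "\<And>x. (CLINT n|measure_pmf P. iexp (x * real n)) = exp (a * (iexp x - 1))"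
    "integrable (measure_pmf P) real" using poisson_char[OF ab(1)] by blast
  obtain Q where Q: "\<And>x. (CLINT n|measure_pmf Q. iexp (x * real n)) = exp (b * (iexp x - 1))"
    "integrable (measure_pmf Q) real" using poisson_char[OF ab(2)] by blast
  interpret PQ: pair_prob_space "measure_pmf P" "measure_pmf Q" ..
  define R where "R = measure_pmf P \<Otimes>\<^sub>M measure_pmf Q"
  define f where "f = (\<lambda>x::nat\<times>nat. real (fst x) * d1 + real (snd x) * d2)"
  interpret R: prob_space R unfolding R_def by (rule PQ.prob_space_axioms)
  have f[measurable]: "f \<in> borel_measurable R"
    unfolding f_def R_def by measurable
  have int: "integrable R f"
    unfolding f_def R_def
    by (intro Bochner_Integration.integrable_add integrable_mult_left; rule PQ.Fubini_integrable)
       (auto simp: P(2) Q(2))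
  have char: "char (distr R borel f) z = char (distr M borel Y) z" for z
  proof -
    have "char (distr R borel f) z = (CLINT x|R. iexp (z * f x))"
      unfolding char_def by (subst integral_distr) auto
    also have "\<dots> = (CLINT x|measure_pmf P. CLINT y|measure_pmf Q. iexp (z * f (x, y)))"
      unfolding R_def
      by (subst PQ.integral_fst'[symmetric])
         (auto simp: R_def[symmetric] intro!: R.integrable_const_bound[of _ 1])
    also have "\<dots> = (CLINT x|measure_pmf P. iexp (z * d1 * real x) * (CLINT y|measure_pmf Q. iexp (z * d2 * real y)))"
      by (subst integral_mult_right_zero[symmetric])
         (simp add: f_def exp_add[symmetric] algebra_simps)
    also have "\<dots> = exp (a * (iexp (z * d1) - 1) + b * (iexp (z * d2) - 1))"
      using P(1)[of "z * d1"] Q(1)[of "z * d2"] by (simp add: exp_add)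
    also have "\<dots> = char (distr M borel Y) z"
      unfolding char_def ch[symmetric] by (subst integral_distr) auto
    finally show ?thesis .
  qed
  have eq: "distr M borel Y = distr R borel f"
    by (rule Levy_uniqueness)
      (auto intro!: M.real_distribution_distr R.real_distribution_distr simp: char fun_eq_iff)
  have "integrable (distr R borel f) (\<lambda>x. x)"
    by (subst integrable_distr_eq) (auto intro: int)
  then have "integrable (distr M borel Y) (\<lambda>x. x)"
    unfolding eq .
  then show "integrable M Y"
    by (subst (asm) integrable_distr_eq) auto
  define D where "D = (\<lambda>(m, n). real m * d1 + real n * d2) ` (UNIV :: (nat \<times> nat) set)"
  have "countable D" unfolding D_def by auto
  then have [measurable]: "D \<in> sets borel"
    by (rule sets.countable[rotated]) auto
  have "AE x in distr R borel f. x \<in> D"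
  proof (subst AE_distr_iff)
    have "f x \<in> D" for x by (cases x) (auto simp: D_def f_def)
    then show "AE x in R. f x \<in> D" by simp
  qed auto
  then have "AE x in distr M borel Y. x \<in> D"
    unfolding eq .
  then have "AE \<omega> in M. Y \<omega> \<in> D"
    by (subst (asm) AE_distr_iff) auto
  then show "AE \<omega> in M. \<exists>m n::nat. Y \<omega> = real m * d1 + real n * d2"
    by eventually_elim (auto simp: D_def)
qed

text \<open>Averaging over the \<open>n\<close>-th roots of unity isolates the coefficients with index congruent to \<open>j\<close>
  modulo \<open>n\<close>; all of them except the \<open>j\<close>-th vanish as \<open>n\<close> grows.\<close>

lemma fourier_coeff_unique:
  fixes d :: "nat \<Rightarrow> complex"
  assumes sm: "summable (\<lambda>i. norm (d i))"
    and zero: "\<And>x. (\<lambda>i. d i * iexp x ^ i) sums 0"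
  shows "d j = 0"
proof -
  have bound: "norm (d j) \<le> (\<Sum>i. norm (d (i + n)))" if n: "n > j" for n
  proof -
    define \<omega> where "\<omega> l = iexp (2 * pi * real l / real n)" for l
    \<comment> \<open>The exponent uses \<open>n - j\<close> instead of \<open>- j\<close> to stay
      natural; as \<open>\<omega> l\<close> is an \<open>n\<close>-th root of unity, this filters
      the same residue class.\<close>
    define s where "s i = (\<Sum>l<n. \<omega> l ^ (n - j + i))" for i
    have s: "s i = (if n dvd n - j + i then of_nat n else 0)" for i
    proof -
      define m where "m = n - j + i"
      define \<zeta> where "\<zeta> = iexp (2 * pi * real m / real n)"
      have pw: "\<omega> l ^ m = \<zeta> ^ l" for l
        unfolding \<omega>_def \<zeta>_def exp_of_nat_mult[symmetric] by (simp add: field_simps)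
      have "\<zeta> ^ n = iexp (2 * pi * real m)"
        unfolding \<zeta>_def exp_of_nat_mult[symmetric] using n by (simp add: field_simps)
      also have "\<dots> = 1"
        unfolding exp_eq_1 by (auto intro!: exI[of _ "int m"])
      finally have \<zeta>n: "\<zeta> ^ n = 1" .
      show ?thesis
      proof (cases "n dvd m")
        case True
        then obtain k where k: "m = n * k" by auto
        have "\<zeta> = iexp (2 * pi * real k)"
          unfolding \<zeta>_def k using n by (simp add: mult_ac)
        also have "\<dots> = 1"
          unfolding exp_eq_1 by (auto intro!: exI[of _ "int k"])
        finally show ?thesis unfolding s_def m_def[symmetric] pw using True by simp
      next
        case False
        have "\<zeta> \<noteq> 1"
        proof
          assume "\<zeta> = 1"
          then obtain k :: int where "2 * pi * real m / real n = of_int (2 * k) * pi"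
            unfolding \<zeta>_def exp_eq_1 by auto
          then have "real_of_int (int m) = real_of_int (k * int n)"
            using n by (simp add: field_simps)
          then have "int m = k * int n"
            by (simp only: of_int_eq_iff)
          then have "int n dvd int m" by simp
          then show False using False by (simp only: int_dvd_int_iff)
        qed
        then show ?thesis unfolding s_def m_def[symmetric] pw
          using False \<zeta>n by (simp add: sum_gp_strict)
      qed
    qed
    have "(\<lambda>i. \<omega> l ^ (n - j) * (d i * \<omega> l ^ i)) sums (\<omega> l ^ (n - j) * 0)" for l
      using zero[of "2 * pi * real l / real n"] by (intro sums_mult) (simp add: \<omega>_def)
    then have "(\<lambda>i. \<Sum>l<n. \<omega> l ^ (n - j) * (d i * \<omega> l ^ i)) sums (\<Sum>l<n. \<omega> l ^ (n - j) * 0)"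
      by (intro sums_sum) auto
    moreover have "(\<Sum>l<n. \<omega> l ^ (n - j) * (d i * \<omega> l ^ i)) = d i * s i" for i
      by (simp add: s_def sum_distrib_left power_add mult_ac)
    ultimately have "(\<lambda>i. d i * s i) sums 0" by simp
    then have "(\<lambda>i. d (i + n) * s (i + n)) sums (0 - (\<Sum>i<n. d i * s i))"
      by (subst sums_iff_shift) simp
    moreover have "(\<Sum>i<n. d i * s i) = (\<Sum>i<n. if i = j then of_nat n * d j else 0)"
    proof (rule sum.cong)
      fix i assume "i \<in> {..<n}"
      then have i: "i < n" by simp
      have "n dvd n - j + i \<longleftrightarrow> i = j"
      proof
        assume "n dvd n - j + i"
        then obtain k where k: "n - j + i = n * k" by auto
        \<comment> \<open>Both \<open>i\<close> and \<open>j\<close> are below \<open>n\<close>, so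
          the exponent lies strictly between 0 and \<open>2 * n\<close>, and \<open>n\<close> is the
          only multiple left.\<close>
        with i n have "0 < n * k" "n * k < n * 2" by linarith+
        then have "k = 1" by simp
        with k i n show "i = j" by simp
      qed (use n in simp)
      then show "d i * s i = (if i = j then of_nat n * d j else 0)"
        by (simp add: s)
    qed simp
    ultimately have "(\<lambda>i. d (i + n) * s (i + n)) sums (- (of_nat n * d j))"
      using n by simp
    then have eq: "of_nat n * d j = - (\<Sum>i. d (i + n) * s (i + n))"
      by (simp add: sums_iff)
    have sm': "summable (\<lambda>i. norm (d (i + n)))"
      using summable_ignore_initial_segment[OF sm] .
    have "norm (of_nat n * d j) \<le> (\<Sum>i. real n * norm (d (i + n)))"
      unfolding eq norm_minus_cancel
      by (rule norm_suminf_le) (auto simp: s norm_mult intro!: summable_mult sm')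
    also have "\<dots> = real n * (\<Sum>i. norm (d (i + n)))"
      by (rule suminf_mult[OF sm'])
    finally show ?thesis using n by (simp add: norm_mult)
  qed
  have "(\<lambda>n. \<Sum>i. norm (d (i + n))) \<longlonglongrightarrow> 0"
    by (rule suminf_exist_split2[OF sm])
  then have "norm (d j) \<le> 0"
    by (rule tendsto_lowerbound) (auto intro!: bound eventually_mono[OF eventually_gt_at_top[of j]])
  then show ?thesis by simp
qed

text \<open>With \<open>z\<close> fixed, both sides of the hypothesis are absolutely convergent
  power series in \<open>iexp x\<close>: the left one by splitting over the value of
  \<open>N\<close>, the right one by the exponential series. Their coefficients must agree.\<close>

lemma joint_poisson_coeff:
  fixes N L :: "'a \<Rightarrow> real" and \<alpha> \<beta> :: complex and z :: real
  assumes "prob_space M" and [measurable]: "N \<in> borel_measurable M" "L \<in> borel_measurable M"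
    and nat: "AE \<omega> in M. \<exists>n::nat. N \<omega> = real n"
    and ch: "\<And>x. (CLINT \<omega>|M. iexp (x * N \<omega> + z * L \<omega>)) = exp (\<beta> * iexp x - \<alpha>)"
  shows "(CLINT \<omega>|M. indicator {\<omega>. N \<omega> = real i} \<omega> *\<^sub>R iexp (z * L \<omega>)) = \<beta> ^ i / fact i * exp (- \<alpha>)"
proof -
  interpret prob_space M by fact
  define g where "g i \<omega> = (indicator {\<omega>. N \<omega> = real i} \<omega> *\<^sub>R iexp (z * L \<omega>))" for i \<omega>
  define a where "a i = (CLINT \<omega>|M. g i \<omega>)" for i
  have [measurable]: "g i \<in> borel_measurable M" for i unfolding g_def by measurable
  have gi: "integrable M (g i)" for i
    by (rule integrable_const_bound[of _ 1]) (auto simp: g_def indicator_def)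
  have ng: "norm (g i \<omega>) = indicator {\<omega>\<in>space M. N \<omega> = real i} \<omega>" if "\<omega> \<in> space M" for i \<omega>
    using that by (auto simp: g_def indicator_def)
  \<comment> \<open>Disjoint events have summable probabilities; this justifies exchanging series
    and integral below.\<close>
  have "disjoint_family (\<lambda>i. {\<omega>\<in>space M. N \<omega> = real i})"
    by (auto simp: disjoint_family_on_def)
  then have "summable (\<lambda>i. measure M {\<omega>\<in>space M. N \<omega> = real i})"
    by (intro finite_measure_UNION[THEN sums_summable]) auto
  moreover have "(\<integral>\<omega>. norm (g i \<omega>) \<partial>M) = measure M {\<omega>\<in>space M. N \<omega> = real i}" for i
    by (subst Bochner_Integration.integral_cong[OF refl ng]) auto
  ultimately have sm: "summable (\<lambda>i. \<integral>\<omega>. norm (g i \<omega>) \<partial>M)" by simp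
  have sma: "summable (\<lambda>i. norm (a i))"
    by (rule summable_comparison_test'[OF sm]) (auto simp: a_def)
  have lhs: "(\<lambda>i. a i * iexp x ^ i) sums exp (\<beta> * iexp x - \<alpha>)" for x
  proof -
    \<comment> \<open>At each sample point at most one index contributes, so the pointwise series is
      a finite sum.\<close>
    have fin: "finite {i. N \<omega> = real i}" for \<omega>
      by (rule finite_subset[of _ "{nat \<lfloor>N \<omega>\<rfloor>}"]) auto
    have "(\<lambda>i. integral\<^sup>L M (\<lambda>\<omega>. g i \<omega> * iexp x ^ i)) sums (CLINT \<omega>|M. (\<Sum>i. g i \<omega> * iexp x ^ i))"
    proof (rule sums_integral)
      show "integrable M (\<lambda>\<omega>. g i \<omega> * iexp x ^ i)" for i
        using gi[of i] by simp
      show "AE \<omega> in M. summable (\<lambda>i. norm (g i \<omega> * iexp x ^ i))"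
      proof (rule AE_I2)
        show "summable (\<lambda>i. norm (g i \<omega> * iexp x ^ i))" for \<omega>
          by (rule summable_finite[OF fin[of \<omega>]]) (auto simp: g_def)
      qed
      show "summable (\<lambda>i. \<integral>\<omega>. norm (g i \<omega> * iexp x ^ i) \<partial>M)"
        using sm by (simp add: norm_mult norm_power)
    qed
    also have "(CLINT \<omega>|M. (\<Sum>i. g i \<omega> * iexp x ^ i)) = (CLINT \<omega>|M. iexp (x * N \<omega> + z * L \<omega>))"
    proof (rule integral_cong_AE)
      show "AE \<omega> in M. (\<Sum>i. g i \<omega> * iexp x ^ i) = iexp (x * N \<omega> + z * L \<omega>)"
        using nat
      proof eventually_elim
        fix \<omega> assume "\<exists>n::nat. N \<omega> = real n"
        then obtain n where n: "N \<omega> = real n" by blast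
        have "(\<Sum>i. g i \<omega> * iexp x ^ i) = (\<Sum>i\<in>{n}. g i \<omega> * iexp x ^ i)"
          by (rule suminf_finite) (auto simp: g_def n)
        also have "\<dots> = iexp (x * N \<omega> + z * L \<omega>)"
          by (simp add: g_def n exp_of_nat_mult[symmetric] exp_add[symmetric] algebra_simps)
        finally show "(\<Sum>i. g i \<omega> * iexp x ^ i) = iexp (x * N \<omega> + z * L \<omega>)" .
      qed
    qed measurable
    finally show ?thesis unfolding ch by (simp add: a_def)
  qed
  have rhs: "(\<lambda>i. \<beta> ^ i / fact i * exp (- \<alpha>) * iexp x ^ i) sums exp (\<beta> * iexp x - \<alpha>)" for x
  proof -
    have "(\<lambda>i. (\<beta> * iexp x) ^ i /\<^sub>R fact i * exp (- \<alpha>)) sums (exp (\<beta> * iexp x) * exp (- \<alpha>))"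
      by (intro sums_mult2 exp_converges)
    then show ?thesis
      by (simp add: exp_diff exp_minus field_simps scaleR_conv_of_real)
  qed
  have z0: "(\<lambda>i. (a i - \<beta> ^ i / fact i * exp (- \<alpha>)) * iexp x ^ i) sums 0" for x
    using sums_diff[OF lhs[of x] rhs[of x]] by (simp only: left_diff_distrib diff_self)
  have sm0: "summable (\<lambda>i. norm (a i - \<beta> ^ i / fact i * exp (- \<alpha>)))"
  proof (rule summable_comparison_test'[of _ 0])
    show "summable (\<lambda>i. norm (a i) + norm (\<beta> ^ i /\<^sub>R fact i) * norm (exp (- \<alpha>)))"
      by (intro summable_add sma summable_mult2 summable_norm_exp)
    show "norm (norm (a i - \<beta> ^ i / fact i * exp (- \<alpha>))) \<le> norm (a i) + norm (\<beta> ^ i /\<^sub>R fact i) * norm (exp (- \<alpha>))" for i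
      using norm_triangle_ineq4[of "a i" "\<beta> ^ i / fact i * exp (- \<alpha>)"]
      by (simp add: norm_mult norm_divide divide_inverse mult_ac norm_inverse)
  qed
  have "a i - \<beta> ^ i / fact i * exp (- \<alpha>) = 0"
    by (rule fourier_coeff_unique[OF sm0 z0])
  then show ?thesis by (simp add: a_def g_def)
qed

section \<open>The bivariate compound Poisson process\<close>

lemma AE_distr_eqD:
  fixes X :: "'a \<Rightarrow> 'c::topological_space" and Y :: "'b \<Rightarrow> 'c"
  assumes "distr M borel X = distr M' borel Y" "X \<in> borel_measurable M" "Y \<in> borel_measurable M'"
    and "{x. P x} \<in> sets borel" "AE \<omega> in M'. P (Y \<omega>)"
  shows "AE \<omega> in M. P (X \<omega>)"
proof -
  have "AE x in distr M' borel Y. P x"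
    using assms by (subst AE_distr_iff) auto
  then have "AE x in distr M borel X. P x" unfolding assms(1) .
  then show ?thesis using assms by (subst (asm) AE_distr_iff) auto
qed

text \<open>The functionals behind \<open>rho\<close> and \<open>mu\<close> are only almost
  everywhere equal to measurable functions. Completeness makes them measurable, and the completion
  does not change the law of \<open>W\<close>.\<close>

lemma as_distr_AE:
  assumes W[measurable]: "W \<in> borel_measurable M" and eq: "AE \<omega> in M. Z \<omega> = W \<omega>"
  shows "as_distr M Z = distr M borel W"
proof -
  have eq': "AE \<omega> in completion M. Z \<omega> = W \<omega>" using eq by (rule AE_completion)
  have Wc: "W \<in> borel_measurable (completion M)" using W by (rule measurable_completion)
  have "Z \<in> borel_measurable (completion M)"
  proof (rule measurableI)
    fix A :: "real set" assume A: "A \<in> sets borel"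
    show "Z -` A \<inter> space (completion M) \<in> sets (completion M)"
    proof (rule completion.in_sets_AE)
      show "AE x in completion M. (x \<in> W -` A \<inter> space (completion M)) = (x \<in> Z -` A \<inter> space (completion M))"
        using eq' by eventually_elim auto
    qed (use measurable_sets[OF Wc A] in auto)
  qed simp
  then have "as_distr M Z = distr (completion M) borel W"
    unfolding as_distr_def by (intro distr_cong_AE) (use eq' Wc in auto)
  then show ?thesis by (simp add: distr_completion)
qed

lemma rational_approx_right:
  fixes s :: real
  obtains q where "\<And>i::nat. q i \<in> \<rat>" "\<And>i. s < q i" "filterlim q (at_right s) sequentially"
proof -
  have "\<exists>x\<in>\<rat>. s < x \<and> x < s + 1 / real (Suc i)" for i by (intro Rats_dense_in_real) simp
  then obtain q where q: "\<And>i. q i \<in> \<rat>" "\<And>i. s < q i" "\<And>i. q i < s + 1 / real (Suc i)" by metis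
  have "(\<lambda>i. s + 1 / real (Suc i)) \<longlonglongrightarrow> s + 0"
    by (intro tendsto_intros LIMSEQ_Suc[OF lim_1_over_n])
  then have "q \<longlonglongrightarrow> s"
    using q by (intro tendsto_sandwich[of "\<lambda>_. s" q _ "\<lambda>i. s + 1 / real (Suc i)"]) (auto intro!: always_eventually less_imp_le[OF q(3)] less_imp_le[OF q(2)] simp del: of_nat_Suc)
  then have "filterlim q (at_right s) sequentially"
    using q(2) by (auto simp: filterlim_at intro!: always_eventually less_imp_neq[THEN not_sym])
  with q show ?thesis by (intro that) auto
qed

text \<open>Almost sure order relations can be secured at countably many times at once; approaching
  \<open>s\<close> and \<open>t\<close> from the right through rationals extends them to all
  times.\<close>

lemma right_cont_mono:
  fixes f :: "real \<Rightarrow> real"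
  assumes right: "\<And>t. 0 \<le> t \<Longrightarrow> (f \<longlongrightarrow> f t) (at_right t)"
    and rat: "\<And>q r. q \<in> \<rat> \<Longrightarrow> r \<in> \<rat> \<Longrightarrow> 0 \<le> q \<Longrightarrow> q \<le> r \<Longrightarrow> f q \<le> f r"
    and st: "0 \<le> s" "s \<le> t"
  shows "f s \<le> f t"
proof (cases "s = t")
  case False
  obtain q where q: "\<And>i::nat. q i \<in> \<rat>" "\<And>i. s < q i" "filterlim q (at_right s) sequentially"
    using rational_approx_right[of s] by blast
  obtain r where r: "\<And>i::nat. r i \<in> \<rat>" "\<And>i. t < r i" "filterlim r (at_right t) sequentially"
    using rational_approx_right[of t] by blast
  have "(\<lambda>i. f (q i)) \<longlonglongrightarrow> f s" "(\<lambda>i. f (r i)) \<longlonglongrightarrow> f t"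
    using right[of s] right[of t] st q(3) r(3) by (auto intro: filterlim_compose)
  \<comment> \<open>Since \<open>q i\<close> tends to \<open>s < t\<close> while
    \<open>r i > t\<close>, the approximating rationals are eventually in the right order.\<close>
  moreover have "eventually (\<lambda>i. f (q i) \<le> f (r i)) sequentially"
  proof -
    have "q \<longlonglongrightarrow> s" using q(3) by (simp add: filterlim_at)
    then have "eventually (\<lambda>i. q i < t) sequentially" using False st by (intro order_tendstoD) auto
    then show ?thesis
    proof eventually_elim
      case (elim i)
      have "0 \<le> q i" "q i \<le> r i" using q(2)[of i] r(2)[of i] elim st by linarith+
      then show ?case by (intro rat q r)
    qed
  qed
  ultimately show ?thesis
    by (intro tendsto_le[OF sequentially_bot, of "\<lambda>i. f (r i)" "f t" "\<lambda>i. f (q i)" "f s"])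
qed simp

lemma right_cont_Nats:
  fixes f :: "real \<Rightarrow> real"
  assumes right: "(f \<longlongrightarrow> f t) (at_right t)" and rat: "\<And>q. q \<in> \<rat> \<Longrightarrow> 0 \<le> q \<Longrightarrow> f q \<in> \<nat>" and "0 \<le> t"
  shows "f t \<in> \<nat>"
proof -
  obtain q where q: "\<And>i::nat. q i \<in> \<rat>" "\<And>i. t < q i" "filterlim q (at_right t) sequentially"
    using rational_approx_right[of t] by blast
  have lim: "(\<lambda>i. f (q i)) \<longlonglongrightarrow> f t" using right q(3) by (rule filterlim_compose)
  have nat: "f (q i) \<in> \<nat>" for i using q(1)[of i] q(2)[of i] assms(3) by (intro rat) auto
  show ?thesis by (rule closed_sequentially[OF closed_Nats nat lim])
qed

text \<open>The derivative of \<open>exp (- a * h)\<close> at 0 along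
  \<open>h = 1 / (m + 1)\<close>. It serves both a complex exponent and the real rate
  \<open>u + w\<close>.\<close>

lemma exp_deriv_seq: "(\<lambda>m. of_nat (Suc m) * (1 - exp (- a / of_nat (Suc m)))) \<longlonglongrightarrow> (a :: 'a :: {real_normed_field, banach})"
proof -
  have "((\<lambda>h. exp (- a * h)) has_field_derivative - a) (at 0)"
    by (auto intro!: derivative_eq_intros)
  then have "((\<lambda>h. (exp (- a * h) - 1) / h) \<longlongrightarrow> - a) (at 0)"
    by (simp add: has_field_derivative_iff)
  moreover have "filterlim (\<lambda>m. 1 / of_nat (Suc m) :: 'a) (at 0) sequentially"
    using LIMSEQ_Suc[OF lim_1_over_n] by (simp add: filterlim_at del: of_nat_Suc)
  ultimately have "(\<lambda>m. (exp (- a * (1 / of_nat (Suc m))) - 1) / (1 / of_nat (Suc m))) \<longlonglongrightarrow> - a"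
    by (rule filterlim_compose)
  then have "(\<lambda>m. - ((exp (- a * (1 / of_nat (Suc m))) - 1) / (1 / of_nat (Suc m)))) \<longlonglongrightarrow> - (- a)"
    by (rule tendsto_minus)
  then show ?thesis by (simp add: algebra_simps del: of_nat_Suc)
qed

text \<open>The coordinatewise form of the process for one fixed \<open>k\<close>. Here
  \<open>d\<close> is the payment at a simultaneous jump, \<open>c powi (-k)\<close> in the
  application, and \<open>u + w\<close> is the jump rate of \<open>N\<close>.\<close>

locale poisson_pair = prob_space M for M :: "'a measure" +
  fixes N L :: "real \<Rightarrow> 'a \<Rightarrow> real" and u v w d :: real
  assumes nonneg: "0 \<le> u" "0 \<le> v" "0 \<le> w" "0 < d" and rate_pos: "0 < u + w"
    and measurable_N: "0 \<le> t \<Longrightarrow> N t \<in> borel_measurable M"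
    and measurable_L: "0 \<le> t \<Longrightarrow> L t \<in> borel_measurable M"
    and zero: "AE \<omega> in M. N 0 \<omega> = 0 \<and> L 0 \<omega> = 0"
    and indep: "0 \<le> g 0 \<Longrightarrow> (\<And>j. j < n \<Longrightarrow> g j < g (Suc j)) \<Longrightarrow>
       indep_vars (\<lambda>_. borel) (\<lambda>j \<omega>. (N (g (Suc j)) \<omega> - N (g j) \<omega>, L (g (Suc j)) \<omega> - L (g j) \<omega>)) {..<n::nat}"
    and stationary: "0 \<le> s \<Longrightarrow> 0 \<le> r \<Longrightarrow>
       distr M borel (\<lambda>\<omega>. (N (s + r) \<omega> - N s \<omega>, L (s + r) \<omega> - L s \<omega>)) =
       distr M borel (\<lambda>\<omega>. (N r \<omega> - N 0 \<omega>, L r \<omega> - L 0 \<omega>))"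
    and right_cont: "AE \<omega> in M. \<forall>t\<ge>0. ((\<lambda>t. N t \<omega>) \<longlongrightarrow> N t \<omega>) (at_right t) \<and> ((\<lambda>t. L t \<omega>) \<longlongrightarrow> L t \<omega>) (at_right t)"
    and joint_char: "0 \<le> t \<Longrightarrow> (CLINT \<omega>|M. iexp (x * N t \<omega> + z * L t \<omega>)) =
       exp (t * (u * (iexp x - 1) + v * (iexp z - 1) + w * (iexp (x + z * d) - 1)))"
begin

section \<open>Almost sure properties of the paths\<close>

lemma AE_N_Nats:
  assumes t: "0 \<le> t"
  shows "AE \<omega> in M. N t \<omega> \<in> \<nat>"
proof -
  \<comment> \<open>At frequency 0 for \<open>L\<close> two Poisson parts remain, with means
    \<open>t * u\<close> and \<open>t * w\<close>, both with jumps of size 1.\<close>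
  have ch: "(CLINT \<omega>|M. iexp (z * N t \<omega>)) = exp ((t * u) * (iexp (z * 1) - 1) + (t * w) * (iexp (z * 1) - 1))" for z
    using joint_char[OF t, of z 0] by (simp add: algebra_simps)
  have "AE \<omega> in M. \<exists>m n::nat. N t \<omega> = real m * 1 + real n * 1"
    by (rule two_poisson_law(1)[OF prob_space_axioms measurable_N[OF t] _ _ ch]) (use t nonneg in auto)
  then show ?thesis by eventually_elim auto
qed

lemma L_law:
  assumes t: "0 \<le> t"
  shows "AE \<omega> in M. 0 \<le> L t \<omega>" "integrable M (L t)"
proof -
  have ch: "(CLINT \<omega>|M. iexp (z * L t \<omega>)) = exp ((t * v) * (iexp (z * 1) - 1) + (t * w) * (iexp (z * d) - 1))" for z
    using joint_char[OF t, of 0 z] by (simp add: algebra_simps)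
  have "AE \<omega> in M. \<exists>m n::nat. L t \<omega> = real m * 1 + real n * d"
    by (rule two_poisson_law(1)[OF prob_space_axioms measurable_L[OF t] _ _ ch]) (use t nonneg in auto)
  then show "AE \<omega> in M. 0 \<le> L t \<omega>" by eventually_elim (use nonneg in auto)
  show "integrable M (L t)"
    by (rule two_poisson_law(2)[OF prob_space_axioms measurable_L[OF t] _ _ ch]) (use t nonneg in auto)
qed

lemma AE_increment:
  assumes "0 \<le> s" "s \<le> t"
  shows "AE \<omega> in M. N t \<omega> - N s \<omega> \<in> \<nat> \<and> 0 \<le> L t \<omega> - L s \<omega>"
proof -
  have r: "0 \<le> t - s" using assms by simp
  have [measurable]: "N s \<in> borel_measurable M" "N t \<in> borel_measurable M" "N (t - s) \<in> borel_measurable M" "N 0 \<in> borel_measurable M"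
    "L s \<in> borel_measurable M" "L t \<in> borel_measurable M" "L (t - s) \<in> borel_measurable M" "L 0 \<in> borel_measurable M"
    using assms by (auto intro: measurable_N measurable_L)
  have "AE \<omega> in M. fst (N t \<omega> - N s \<omega>, L t \<omega> - L s \<omega>) \<in> \<nat> \<and> 0 \<le> snd (N t \<omega> - N s \<omega>, L t \<omega> - L s \<omega>)"
  proof (rule AE_distr_eqD[where P="\<lambda>x. fst x \<in> \<nat> \<and> 0 \<le> snd x"])
    show "distr M borel (\<lambda>\<omega>. (N t \<omega> - N s \<omega>, L t \<omega> - L s \<omega>)) = distr M borel (\<lambda>\<omega>. (N (t - s) \<omega> - N 0 \<omega>, L (t - s) \<omega> - L 0 \<omega>))"
      using stationary[OF assms(1) r] by simp
    have "closed ((fst -` \<nat>) \<inter> (snd -` {0..}) :: (real \<times> real) set)"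
      by (intro closed_Int closed_vimage continuous_intros) auto
    then have "(fst -` \<nat>) \<inter> (snd -` {0..}) \<in> sets (borel :: (real \<times> real) measure)" by simp
    also have "(fst -` \<nat>) \<inter> (snd -` {0..}) = {x :: real \<times> real. fst x \<in> \<nat> \<and> 0 \<le> snd x}" by auto
    finally show "{x :: real \<times> real. fst x \<in> \<nat> \<and> 0 \<le> snd x} \<in> sets borel" .
    show "AE \<omega> in M. fst (N (t - s) \<omega> - N 0 \<omega>, L (t - s) \<omega> - L 0 \<omega>) \<in> \<nat> \<and>
        0 \<le> snd (N (t - s) \<omega> - N 0 \<omega>, L (t - s) \<omega> - L 0 \<omega>)"
      using zero AE_N_Nats[OF r] L_law(1)[OF r] by eventually_elim auto
  qed auto
  then show ?thesis unfolding fst_conv snd_conv .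
qed

text \<open>The coefficient formula at frequency 0 for \<open>L\<close>, where both constants
  \<open>\<alpha>\<close> and \<open>\<beta>\<close> become \<open>(u + w) * t\<close>.\<close>

lemma prob_N_eq:
  assumes t: "0 \<le> t"
  shows "measure M {\<omega>\<in>space M. N t \<omega> = real i} = ((u + w) * t) ^ i / fact i * exp (- ((u + w) * t))"
proof -
  note [measurable] = measurable_N[OF t] measurable_L[OF t]
  have "(CLINT \<omega>|M. indicator {\<omega>. N t \<omega> = real i} \<omega> *\<^sub>R iexp (0 * L t \<omega>)) =
      of_real ((u + w) * t) ^ i / fact i * exp (- of_real ((u + w) * t))"
  proof (rule joint_poisson_coeff[OF prob_space_axioms])
    show "AE \<omega> in M. \<exists>n::nat. N t \<omega> = real n"
      using AE_N_Nats[OF t] by eventually_elim (auto elim: Nats_cases)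
    show "(CLINT \<omega>|M. iexp (x * N t \<omega> + 0 * L t \<omega>)) = exp (of_real ((u + w) * t) * iexp x - of_real ((u + w) * t))" for x
      unfolding joint_char[OF t] by (simp add: algebra_simps)
  qed measurable
  also have "(CLINT \<omega>|M. indicator {\<omega>. N t \<omega> = real i} \<omega> *\<^sub>R iexp (0 * L t \<omega>)) =
      (CLINT \<omega>|M. of_real (indicator {\<omega>\<in>space M. N t \<omega> = real i} \<omega>))"
    by (intro Bochner_Integration.integral_cong) (auto simp: indicator_def)
  also have "\<dots> = of_real (measure M {\<omega>\<in>space M. N t \<omega> = real i})"
    by simp
  finally show ?thesis
    by (metis (mono_tags, lifting) exp_of_real of_real_divide of_real_eq_iff of_real_fact of_real_minus of_real_mult of_real_power)
qed

text \<open>A path without jumps vanishes at every natural time; for each \<open>i\<close> this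
  event has probability at most \<open>exp (- (u + w)) ^ i\<close>, which tends to 0.\<close>

lemma AE_jump: "AE \<omega> in M. \<exists>t\<ge>0. N t \<omega> \<noteq> 0"
proof -
  note [measurable] = measurable_N
  have meas: "{\<omega>\<in>space M. \<forall>i::nat. N (real i) \<omega> = 0} \<in> sets M" by measurable
  have "measure M {\<omega>\<in>space M. \<forall>i::nat. N (real i) \<omega> = 0} \<le> exp (- (u + w)) ^ i" for i
  proof -
    have "measure M {\<omega>\<in>space M. \<forall>i::nat. N (real i) \<omega> = 0} \<le> measure M {\<omega>\<in>space M. N (real i) \<omega> = real 0}"
      by (rule finite_measure_mono) auto
    also have "\<dots> = exp (- (u + w)) ^ i"
      using prob_N_eq[of "real i" 0] by (simp add: exp_of_nat_mult[symmetric] algebra_simps)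
    finally show ?thesis .
  qed
  moreover have "(\<lambda>i. exp (- (u + w)) ^ i) \<longlonglongrightarrow> 0"
    using rate_pos by (intro LIMSEQ_realpow_zero) auto
  ultimately have "measure M {\<omega>\<in>space M. \<forall>i::nat. N (real i) \<omega> = 0} \<le> 0"
    by (intro LIMSEQ_le_const) auto
  then have "measure M {\<omega>\<in>space M. \<forall>i::nat. N (real i) \<omega> = 0} = 0"
    by (simp add: measure_le_0_iff)
  then have "AE \<omega> in M. \<not> (\<forall>i::nat. N (real i) \<omega> = 0)"
    using meas by (subst AE_iff_measurable[OF _ refl]) (auto simp: emeasure_eq_measure)
  then show ?thesis
  proof eventually_elim
    case (elim \<omega>)
    then obtain i :: nat where "N (real i) \<omega> \<noteq> 0" by blast
    then show ?case by (intro exI[of _ "real i"]) simp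
  qed
qed

lemma nn_integral_increment:
  assumes [measurable]: "g \<in> borel_measurable borel" and "0 \<le> s" "0 \<le> r"
  shows "(\<integral>\<^sup>+\<omega>. g (N (s + r) \<omega> - N s \<omega>, L (s + r) \<omega> - L s \<omega>) \<partial>M) = (\<integral>\<^sup>+\<omega>. g (N r \<omega>, L r \<omega>) \<partial>M)"
proof -
  have [measurable]: "N s \<in> borel_measurable M" "N r \<in> borel_measurable M" "N (s + r) \<in> borel_measurable M" "N 0 \<in> borel_measurable M"
    "L s \<in> borel_measurable M" "L r \<in> borel_measurable M" "L (s + r) \<in> borel_measurable M" "L 0 \<in> borel_measurable M"
    using assms by (auto intro: measurable_N measurable_L)
  have "(\<integral>\<^sup>+\<omega>. g (N (s + r) \<omega> - N s \<omega>, L (s + r) \<omega> - L s \<omega>) \<partial>M) =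
      (\<integral>\<^sup>+x. g x \<partial>distr M borel (\<lambda>\<omega>. (N (s + r) \<omega> - N s \<omega>, L (s + r) \<omega> - L s \<omega>)))"
    by (subst nn_integral_distr) auto
  also have "\<dots> = (\<integral>\<^sup>+\<omega>. g (N r \<omega> - N 0 \<omega>, L r \<omega> - L 0 \<omega>) \<partial>M)"
    unfolding stationary[OF assms(2,3)] by (subst nn_integral_distr) auto
  also have "\<dots> = (\<integral>\<^sup>+\<omega>. g (N r \<omega>, L r \<omega>) \<partial>M)"
    by (rule nn_integral_cong_AE) (use zero in \<open>eventually_elim, simp\<close>)
  finally show ?thesis .
qed

text \<open>The expected discount over one unit of time is at most some \<open>r < 1\<close>. By
  independence the expected \<open>i\<close>-th term is at most \<open>r ^ i\<close> times the mean
  of \<open>\<bar>L 1\<bar>\<close>, and a series with finite expectation converges almost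
  surely.\<close>

lemma AE_summable:
  assumes \<kappa>: "0 \<le> \<kappa>" "\<kappa> < 1"
  shows "AE \<omega> in M. summable (\<lambda>i. wt \<kappa> (N (real i) \<omega>) * (L (real (Suc i)) \<omega> - L (real i) \<omega>))"
proof -
  note [measurable] = measurable_N measurable_L
  have [measurable]: "N 1 \<in> borel_measurable M" by (rule measurable_N) simp
  define K where "K j \<omega> = wt \<kappa> (N (real (Suc j)) \<omega> - N (real j) \<omega>)" for j \<omega>
  \<comment> \<open>The absolute value makes the terms nonnegative everywhere; almost surely it
    changes nothing.\<close>
  define Y where "Y j \<omega> = \<bar>L (real (Suc j)) \<omega> - L (real j) \<omega>\<bar>" for j \<omega>
  define Z where "Z i \<omega> = (\<Prod>j<i. K j \<omega>) * Y i \<omega>" for i \<omega>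
  have [measurable]: "K j \<in> borel_measurable M" "Y j \<in> borel_measurable M" for j
    unfolding K_def[abs_def] Y_def[abs_def] by measurable
  have [measurable]: "Z i \<in> borel_measurable M" for i unfolding Z_def[abs_def] by measurable
  have K0: "0 \<le> K j \<omega>" "K j \<omega> \<le> 1" for j \<omega> by (auto simp: K_def wt_bounds \<kappa>)
  have Y0: "0 \<le> Y j \<omega>" for j \<omega> by (simp add: Y_def)
  have Z0: "0 \<le> Z j \<omega>" for j \<omega> by (auto simp: Z_def K0 Y0 intro!: mult_nonneg_nonneg prod_nonneg)
  define p0 where "p0 = exp (- (u + w))"
  \<comment> \<open>\<open>\<kappa> ^ i\<close> is 1 for \<open>i = 0\<close> and at most
    \<open>\<kappa>\<close> otherwise, and \<open>p0\<close> is the probability of no jump in unit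
    time, so \<open>r\<close> bounds the mean discount.\<close>
  define r where "r = \<kappa> + (1 - \<kappa>) * p0"
  have p0: "0 < p0" "p0 < 1" using rate_pos by (auto simp: p0_def)
  have r0: "0 \<le> r" using \<kappa> p0 by (auto simp: r_def)
  have "(1 - \<kappa>) * p0 < (1 - \<kappa>) * 1" using \<kappa> p0 by (intro mult_strict_left_mono) auto
  then have r1: "r < 1" by (simp add: r_def)
  define EL where "EL = (\<integral>\<^sup>+\<omega>. ennreal \<bar>L 1 \<omega>\<bar> \<partial>M)"
  have EL: "EL < top"
    using L_law(2)[of 1] by (simp add: EL_def integrable_iff_bounded)
  have EK: "(\<integral>\<^sup>+\<omega>. ennreal (K j \<omega>) \<partial>M) \<le> ennreal r" for j
  proof -
    have "(\<integral>\<^sup>+\<omega>. ennreal (K j \<omega>) \<partial>M) = (\<integral>\<^sup>+\<omega>. ennreal (wt \<kappa> (N 1 \<omega>)) \<partial>M)"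
      using nn_integral_increment[of "\<lambda>x. ennreal (wt \<kappa> (fst x))" "real j" 1]
      by (simp add: K_def add.commute)
    also have "\<dots> \<le> (\<integral>\<^sup>+\<omega>. ennreal (\<kappa> + (1 - \<kappa>) * indicator {\<omega>\<in>space M. N 1 \<omega> = real 0} \<omega>) \<partial>M)"
    proof (rule nn_integral_mono_AE)
      show "AE \<omega> in M. ennreal (wt \<kappa> (N 1 \<omega>)) \<le> ennreal (\<kappa> + (1 - \<kappa>) * indicator {\<omega>\<in>space M. N 1 \<omega> = real 0} \<omega>)"
        using AE_N_Nats[of 1, simplified] AE_space
      proof eventually_elim
        case (elim \<omega>)
        then obtain i where i: "N 1 \<omega> = real i" by (auto elim: Nats_cases)
        show ?case
        proof (cases i)
          case 0
          with i elim show ?thesis by (simp add: wt_def)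
        next
          case (Suc j)
          have "\<kappa> ^ i \<le> \<kappa>" using \<kappa> Suc by (simp add: mult_left_le power_le_one)
          with i elim Suc show ?thesis using \<kappa> by (intro ennreal_leI) (simp del: of_nat_Suc)
        qed
      qed
    qed
    also have "\<dots> = ennreal (\<integral>\<omega>. \<kappa> + (1 - \<kappa>) * indicator {\<omega>\<in>space M. N 1 \<omega> = real 0} \<omega> \<partial>M)"
    proof (rule nn_integral_eq_integral)
      show "integrable M (\<lambda>\<omega>. \<kappa> + (1 - \<kappa>) * indicator {\<omega>\<in>space M. N 1 \<omega> = real 0} \<omega>)"
        by (intro Bochner_Integration.integrable_add integrable_mult_right integrable_real_indicator)
           (auto simp: less_top[symmetric])
    qed (use \<kappa> in \<open>auto simp: indicator_def\<close>)
    also have "(\<integral>\<omega>. \<kappa> + (1 - \<kappa>) * indicator {\<omega>\<in>space M. N 1 \<omega> = real 0} \<omega> \<partial>M) = r"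
    proof (subst Bochner_Integration.integral_add)
      show "integrable M (\<lambda>\<omega>. (1 - \<kappa>) * indicator {\<omega>\<in>space M. N 1 \<omega> = real 0} \<omega>)"
        by (intro integrable_mult_right integrable_real_indicator) (auto simp: less_top[symmetric])
      show "(\<integral>\<omega>. \<kappa> \<partial>M) + (\<integral>\<omega>. (1 - \<kappa>) * indicator {\<omega>\<in>space M. N 1 \<omega> = real 0} \<omega> \<partial>M) = r"
        using prob_N_eq[of 1 0] by (simp add: r_def p0_def prob_space)
    qed auto
    finally show ?thesis .
  qed
  have EY: "(\<integral>\<^sup>+\<omega>. ennreal (Y j \<omega>) \<partial>M) = EL" for j
    using nn_integral_increment[of "\<lambda>x. ennreal \<bar>snd x\<bar>" "real j" 1]
    by (simp add: Y_def EL_def add.commute)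
  have EZ: "(\<integral>\<^sup>+\<omega>. ennreal (Z i \<omega>) \<partial>M) \<le> ennreal (r ^ i) * EL" for i
  proof -
    \<comment> \<open>One family for each \<open>i\<close>: the discounts of the steps before
      \<open>i\<close> and the payment of step \<open>i\<close>. They depend on distinct increments,
      so the expectation factorises.\<close>
    define X where "X j \<omega> = (if j < i then ennreal (K j \<omega>) else ennreal (Y j \<omega>))" for j \<omega>
    have "indep_vars (\<lambda>_. borel) (\<lambda>j \<omega>. (\<lambda>j x. if j < i then ennreal (wt \<kappa> (fst x)) else ennreal \<bar>snd x\<bar>) j
        (N (real (Suc j)) \<omega> - N (real j) \<omega>, L (real (Suc j)) \<omega> - L (real j) \<omega>)) {..<Suc i}"
      by (intro indep_vars_compose2[OF indep]) auto
    then have ind: "indep_vars (\<lambda>_. borel) X {..<Suc i}"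
      by (rule indep_vars_cong[THEN iffD1, rotated 3]) (auto simp: X_def K_def Y_def)
    have "(\<integral>\<^sup>+\<omega>. ennreal (Z i \<omega>) \<partial>M) = (\<integral>\<^sup>+\<omega>. (\<Prod>j<Suc i. X j \<omega>) \<partial>M)"
      by (intro nn_integral_cong) (simp add: Z_def X_def ennreal_mult' K0 Y0 prod_ennreal prod_nonneg)
    also have "\<dots> = (\<Prod>j<Suc i. \<integral>\<^sup>+\<omega>. X j \<omega> \<partial>M)"
      by (rule indep_vars_nn_integral[OF _ ind]) auto
    also have "\<dots> = (\<Prod>j<i. \<integral>\<^sup>+\<omega>. ennreal (K j \<omega>) \<partial>M) * EL"
      by (simp add: X_def EY)
    also have "\<dots> \<le> (\<Prod>j<i. ennreal r) * EL"
      by (intro mult_right_mono prod_mono_ennreal EK) auto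
    finally show ?thesis by (simp add: ennreal_power r0)
  qed
  have "(\<integral>\<^sup>+\<omega>. (\<Sum>i. ennreal (Z i \<omega>)) \<partial>M) = (\<Sum>i. \<integral>\<^sup>+\<omega>. ennreal (Z i \<omega>) \<partial>M)"
    by (rule nn_integral_suminf) measurable
  also have "\<dots> \<le> (\<Sum>i. ennreal (r ^ i) * EL)"
    by (intro suminf_le EZ) auto
  also have "\<dots> = (\<Sum>i. ennreal (r ^ i)) * EL"
    by simp
  also have "\<dots> < top"
  proof (rule ennreal_mult_less_top[THEN iffD2])
    have "(\<Sum>i. ennreal (r ^ i)) \<noteq> top"
      using r0 r1 by (intro ennreal_suminf_neq_top summable_geometric) auto
    then show "(\<Sum>i. ennreal (r ^ i)) = 0 \<or> EL = 0 \<or> (\<Sum>i. ennreal (r ^ i)) < top \<and> EL < top"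
      using EL by (auto simp: top.not_eq_extremum)
  qed
  finally have "(\<integral>\<^sup>+\<omega>. (\<Sum>i. ennreal (Z i \<omega>)) \<partial>M) \<noteq> \<infinity>" by simp
  then have "AE \<omega> in M. (\<Sum>i. ennreal (Z i \<omega>)) \<noteq> \<infinity>"
    by (intro nn_integral_PInf_AE) auto
  moreover have "AE \<omega> in M. \<forall>i::nat. N (real (Suc i)) \<omega> - N (real i) \<omega> \<in> \<nat> \<and> 0 \<le> L (real (Suc i)) \<omega> - L (real i) \<omega>"
    unfolding AE_all_countable by (intro allI AE_increment) auto
  ultimately show ?thesis using zero
  proof eventually_elim
    case (elim \<omega>)
    have "Z i \<omega> = wt \<kappa> (N (real i) \<omega>) * (L (real (Suc i)) \<omega> - L (real i) \<omega>)" for i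
      unfolding Z_def K_def Y_def
      using elim by (subst prod_wt_telescope) auto
    moreover have "summable (\<lambda>i. Z i \<omega>)"
      using elim by (intro summable_suminf_not_top Z0) auto
    ultimately show ?case by simp
  qed
qed

text \<open>One null set serves all pairs of rational times, because there are countably many;
  right-continuity supplies the remaining times.\<close>

lemma AE_step_path:
  assumes \<kappa>: "0 \<le> \<kappa>" "\<kappa> < 1"
  shows "AE \<omega> in M. step_path (\<lambda>t. N t \<omega>) (\<lambda>t. L t \<omega>) \<kappa>"
proof -
  have rat: "AE \<omega> in M. \<forall>q\<in>\<rat>\<inter>{0..}. \<forall>r\<in>\<rat>\<inter>{q..}. N r \<omega> - N q \<omega> \<in> \<nat> \<and> 0 \<le> L r \<omega> - L q \<omega>"
    by (intro AE_ball_countable' AE_increment) (auto simp: countable_rat)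
  show ?thesis
    using rat right_cont zero AE_summable[OF \<kappa>]
  proof eventually_elim
    case (elim \<omega>)
    have inc: "N r \<omega> - N q \<omega> \<in> \<nat>" "N q \<omega> \<le> N r \<omega>" "L q \<omega> \<le> L r \<omega>"
      if "q \<in> \<rat>" "r \<in> \<rat>" "0 \<le> q" "q \<le> r" for q r
    proof -
      show N: "N r \<omega> - N q \<omega> \<in> \<nat>" and "L q \<omega> \<le> L r \<omega>"
        using elim(1) that by auto
      from N show "N q \<omega> \<le> N r \<omega>" by (auto elim!: Nats_cases simp: algebra_simps)
    qed
    show ?case
    proof
      show "N 0 \<omega> = 0" "L 0 \<omega> = 0" using elim by auto
      show N_right: "((\<lambda>t. N t \<omega>) \<longlongrightarrow> N t \<omega>) (at_right t)"
        and L_right: "((\<lambda>t. L t \<omega>) \<longlongrightarrow> L t \<omega>) (at_right t)" if "0 \<le> t" for t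
        using elim(2) that by auto
      show "N s \<omega> \<le> N t \<omega>" if "0 \<le> s" "s \<le> t" for s t
        by (rule right_cont_mono[of "\<lambda>t. N t \<omega>", OF N_right inc(2) that])
      show "L s \<omega> \<le> L t \<omega>" if "0 \<le> s" "s \<le> t" for s t
        by (rule right_cont_mono[of "\<lambda>t. L t \<omega>", OF L_right inc(3) that])
      have N_rat: "N q \<omega> \<in> \<nat>" if "q \<in> \<rat>" "0 \<le> q" for q
        using inc(1)[of 0 q] elim(3) that by simp
      have "N t \<omega> \<in> \<nat>" if "0 \<le> t" for t
        by (rule right_cont_Nats[of "\<lambda>t. N t \<omega>", OF N_right[OF that] N_rat that])
      then show "\<exists>i::nat. N t \<omega> = real i" if "0 \<le> t" for t
        using that by (auto elim: Nats_cases)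
    qed (use elim \<kappa> in auto)
  qed
qed

text \<open>Up to time \<open>h\<close> the process \<open>N\<close> jumps at least twice with probability \<open>o(h)\<close>; the bound isolates
  the contributions of no jump and of exactly one jump.\<close>

lemma small_time_bound:
  fixes W :: "'a \<Rightarrow> real"
  assumes \<kappa>: "0 \<le> \<kappa>" "\<kappa> < 1" and h: "0 \<le> h" and [measurable]: "W \<in> borel_measurable M"
    and fix_eq: "(CLINT \<omega>|M. iexp (z * W \<omega>)) =
      (CLINT \<omega>|M. iexp (z * L h \<omega>) * (CLINT \<omega>'|M. iexp (z * wt \<kappa> (N h \<omega>) * W \<omega>')))"
  defines "\<alpha> \<equiv> of_real (u + v + w) - of_real v * iexp z" and "\<beta> \<equiv> of_real u + of_real w * iexp (z * d)"
  shows "norm ((CLINT \<omega>|M. iexp (z * W \<omega>)) * (1 - exp (- (h * \<alpha>)))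
      - h * \<beta> * exp (- (h * \<alpha>)) * (CLINT \<omega>|M. iexp (z * \<kappa> * W \<omega>)))
    \<le> 1 - exp (- ((u + w) * h)) - (u + w) * h * exp (- ((u + w) * h))"
proof -
  note [measurable] = measurable_N[OF h] measurable_L[OF h]
  define \<Phi> where "\<Phi> y = (CLINT \<omega>|M. iexp (y * W \<omega>))" for y
  define I where "I i \<omega> = (indicator {\<omega>. N h \<omega> = real i} \<omega> :: real)" for i \<omega>
  define g where "g \<omega> = iexp (z * L h \<omega>)" for \<omega>
  have ng: "norm (g \<omega>) = 1" for \<omega> by (simp add: g_def)
  have n\<Phi>: "norm (\<Phi> y) \<le> 1" for y
    unfolding \<Phi>_def using integral_norm_bound[of M "\<lambda>\<omega>. iexp (y * W \<omega>)"] by (simp add: prob_space)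
  interpret W: real_distribution "distr M borel W" by (rule real_distribution_distr) simp
  have "\<Phi> = char (distr M borel W)"
    unfolding \<Phi>_def char_def by (rule ext, subst integral_distr) auto
  then have [measurable]: "\<Phi> \<in> borel_measurable borel" by simp
  have [measurable]: "g \<in> borel_measurable M" "I i \<in> borel_measurable M" for i
    unfolding g_def[abs_def] I_def[abs_def] by measurable
  \<comment> \<open>As a function of \<open>x\<close> the joint characteristic function is
    \<open>exp (h * \<beta> * iexp x - h * \<alpha>)\<close>, which makes the parts with zero and
    one jump explicit.\<close>
  have coeff: "(CLINT \<omega>|M. I i \<omega> *\<^sub>R g \<omega>) = (h * \<beta>) ^ i / fact i * exp (- (h * \<alpha>))" for i
    unfolding I_def g_def
  proof (rule joint_poisson_coeff[OF prob_space_axioms])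
    show "AE \<omega> in M. \<exists>n::nat. N h \<omega> = real n"
      using AE_N_Nats[OF h] by eventually_elim (auto elim: Nats_cases)
    show "(CLINT \<omega>|M. iexp (x * N h \<omega> + z * L h \<omega>)) = exp (h * \<beta> * iexp x - h * \<alpha>)" for x
      unfolding joint_char[OF h] \<alpha>_def \<beta>_def by (simp add: algebra_simps exp_add)
  qed measurable
  have fe: "(CLINT \<omega>|M. g \<omega> * \<Phi> (z * wt \<kappa> (N h \<omega>))) = \<Phi> z"
    unfolding g_def \<Phi>_def by (rule fix_eq[symmetric])
  have int1: "integrable M (\<lambda>\<omega>. g \<omega> * \<Phi> (z * wt \<kappa> (N h \<omega>)))"
    by (rule integrable_const_bound[of _ 1]) (auto simp: norm_mult ng n\<Phi>)
  have int2: "integrable M (\<lambda>\<omega>. I i \<omega> *\<^sub>R g \<omega> * y)" for i y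
    by (rule integrable_const_bound[of _ "norm y"]) (auto simp: norm_mult ng I_def indicator_def)
  have "(CLINT \<omega>|M. g \<omega> * \<Phi> (z * wt \<kappa> (N h \<omega>)) - I 0 \<omega> *\<^sub>R g \<omega> * \<Phi> z - I 1 \<omega> *\<^sub>R g \<omega> * \<Phi> (z * \<kappa>)) =
      \<Phi> z - (CLINT \<omega>|M. I 0 \<omega> *\<^sub>R g \<omega>) * \<Phi> z - (CLINT \<omega>|M. I 1 \<omega> *\<^sub>R g \<omega>) * \<Phi> (z * \<kappa>)"
    by (simp only: Bochner_Integration.integral_diff Bochner_Integration.integrable_diff int1 int2 fe integral_mult_left_zero)
  also have "\<dots> = \<Phi> z * (1 - exp (- (h * \<alpha>))) - h * \<beta> * exp (- (h * \<alpha>)) * \<Phi> (z * \<kappa>)"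
    unfolding coeff by (simp add: algebra_simps)
  finally have "norm (\<Phi> z * (1 - exp (- (h * \<alpha>))) - h * \<beta> * exp (- (h * \<alpha>)) * \<Phi> (z * \<kappa>)) =
      norm (CLINT \<omega>|M. g \<omega> * \<Phi> (z * wt \<kappa> (N h \<omega>)) - I 0 \<omega> *\<^sub>R g \<omega> * \<Phi> z - I 1 \<omega> *\<^sub>R g \<omega> * \<Phi> (z * \<kappa>))"
    by simp
  also have "\<dots> \<le> (\<integral>\<omega>. norm (g \<omega> * \<Phi> (z * wt \<kappa> (N h \<omega>)) - I 0 \<omega> *\<^sub>R g \<omega> * \<Phi> z - I 1 \<omega> *\<^sub>R g \<omega> * \<Phi> (z * \<kappa>)) \<partial>M)"
    by (rule integral_norm_bound)
  also have "\<dots> \<le> (\<integral>\<omega>. 1 - I 0 \<omega> - I 1 \<omega> \<partial>M)"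
  proof (rule integral_mono)
    show "integrable M (\<lambda>\<omega>. norm (g \<omega> * \<Phi> (z * wt \<kappa> (N h \<omega>)) - I 0 \<omega> *\<^sub>R g \<omega> * \<Phi> z - I 1 \<omega> *\<^sub>R g \<omega> * \<Phi> (z * \<kappa>)))"
      by (intro integrable_norm Bochner_Integration.integrable_diff int1 int2)
    show "integrable M (\<lambda>\<omega>. 1 - I 0 \<omega> - I 1 \<omega>)"
      by (rule integrable_const_bound[of _ 1]) (auto simp: I_def indicator_def)
    \<comment> \<open>Where \<open>N h\<close> is 0 or 1 the weight is 1 or \<open>\<kappa>\<close>
      and the difference vanishes; elsewhere only the first term remains, of norm at most 1.\<close>
    show "norm (g \<omega> * \<Phi> (z * wt \<kappa> (N h \<omega>)) - I 0 \<omega> *\<^sub>R g \<omega> * \<Phi> z - I 1 \<omega> *\<^sub>R g \<omega> * \<Phi> (z * \<kappa>)) \<le> 1 - I 0 \<omega> - I 1 \<omega>" for \<omega>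
      using n\<Phi>[of "z * wt \<kappa> (N h \<omega>)"]
      by (cases "N h \<omega> = 0"; cases "N h \<omega> = 1") (auto simp: I_def wt_def norm_mult ng)
  qed
  also have "\<dots> = 1 - measure M {\<omega>\<in>space M. N h \<omega> = real 0} - measure M {\<omega>\<in>space M. N h \<omega> = real 1}"
  proof -
    have "integrable M (I i)" for i
      by (rule integrable_const_bound[of _ 1]) (auto simp: I_def indicator_def)
    moreover have "(\<integral>\<omega>. I i \<omega> \<partial>M) = measure M {\<omega>\<in>space M. N h \<omega> = real i}" for i
    proof -
      have "(\<integral>\<omega>. I i \<omega> \<partial>M) = (\<integral>\<omega>. indicator {\<omega>\<in>space M. N h \<omega> = real i} \<omega> \<partial>M)"
        by (intro Bochner_Integration.integral_cong) (auto simp: I_def indicator_def)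
      then show ?thesis by simp
    qed
    ultimately show ?thesis by (simp add: prob_space)
  qed
  also have "\<dots> = 1 - exp (- ((u + w) * h)) - (u + w) * h * exp (- ((u + w) * h))"
    unfolding prob_N_eq[OF h] by simp
  finally show ?thesis unfolding \<Phi>_def .
qed

text \<open>\<open>W\<close> is a measurable version of the pathwise integral. The small-time bound
  is applied to the grid totals, for which the fixed-point equation is exact, and scaled by the
  \<open>Suc m\<close> cells per unit time; only then is the mesh refined.\<close>

lemma functional_equation:
  assumes \<kappa>: "0 \<le> \<kappa>" "\<kappa> < 1"
  obtains W where "W \<in> borel_measurable M"
    "AE \<omega> in M. step_path.total (\<lambda>t. N t \<omega>) (\<lambda>t. L t \<omega>) \<kappa> = W \<omega>"
    "\<And>z. (of_real (u + v + w) - of_real v * iexp z) * (CLINT \<omega>|M. iexp (z * W \<omega>)) =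
       (of_real u + of_real w * iexp (z * d)) * (CLINT \<omega>|M. iexp (z * \<kappa> * W \<omega>))"
proof -
  have [measurable]: "N (real i / real m) \<in> borel_measurable M" "L (real i / real m) \<in> borel_measurable M"
      "N (1 / real m) \<in> borel_measurable M" "L (1 / real m) \<in> borel_measurable M" for i m
    by (auto intro: measurable_N measurable_L)
  have [measurable]: "N 0 \<in> borel_measurable M" "L 0 \<in> borel_measurable M"
    by (auto intro: measurable_N measurable_L)
  define X where "X m i \<omega> = (wt \<kappa> (N (real (Suc i) / real m) \<omega> - N (real i / real m) \<omega>),
      L (real (Suc i) / real m) \<omega> - L (real i / real m) \<omega>)" for m i \<omega>
  have X[measurable]: "X m i \<in> borel_measurable M" for m i
    unfolding X_def[abs_def] by measurable
  \<comment> \<open>\<open>lim\<close> is a total function, so \<open>V\<close> and \<open>W\<close>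
    are measurable everywhere; their intended values are guaranteed on step paths, which is almost
    surely enough.\<close>
  define V where "V m \<omega> = lim (\<lambda>K. perp (\<lambda>i. X m i \<omega>) K)" for m \<omega>
  define W where "W \<omega> = lim (\<lambda>m. V (Suc m) \<omega>)" for \<omega>
  have V[measurable]: "V m \<in> borel_measurable M" for m unfolding V_def[abs_def] by measurable
  have W[measurable]: "W \<in> borel_measurable M" unfolding W_def[abs_def] by measurable
  have grid: "(\<lambda>K. perp (\<lambda>i. X (Suc m) i \<omega>) K) \<longlonglongrightarrow> V (Suc m) \<omega> \<and>
      V (Suc m) \<omega> = step_path.grid_total (\<lambda>t. N t \<omega>) (\<lambda>t. L t \<omega>) \<kappa> (Suc m)"
    if "step_path (\<lambda>t. N t \<omega>) (\<lambda>t. L t \<omega>) \<kappa>" for m \<omega>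
    using step_path.perp_grid[OF that, of "Suc m"] limI unfolding V_def X_def by auto
  have limW: "(\<lambda>m. V (Suc m) \<omega>) \<longlonglongrightarrow> W \<omega> \<and> step_path.total (\<lambda>t. N t \<omega>) (\<lambda>t. L t \<omega>) \<kappa> = W \<omega>"
    if sp: "step_path (\<lambda>t. N t \<omega>) (\<lambda>t. L t \<omega>) \<kappa>" for \<omega>
  proof -
    have "(\<lambda>m. V (Suc m) \<omega>) \<longlonglongrightarrow> step_path.total (\<lambda>t. N t \<omega>) (\<lambda>t. L t \<omega>) \<kappa>"
      using LIMSEQ_Suc[OF step_path.grid_total_tendsto[OF sp]] grid[OF sp] by simp
    with limI[OF this] show ?thesis by (simp add: W_def)
  qed
  have fix_eq: "(CLINT \<omega>|M. iexp (z * V (Suc m) \<omega>)) =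
      (CLINT \<omega>|M. iexp (z * L (1 / real (Suc m)) \<omega>) * (CLINT \<omega>'|M. iexp (z * wt \<kappa> (N (1 / real (Suc m)) \<omega>) * V (Suc m) \<omega>')))" for m z
  proof -
    define h where "h = 1 / real (Suc m)"
    have [measurable]: "N h \<in> borel_measurable M" "L h \<in> borel_measurable M" by (simp_all add: h_def del: of_nat_Suc)
    \<comment> \<open>Turns an increment of the process into a perpetuity step: discount factor and
      payment.\<close>
    define \<phi> :: "real \<times> real \<Rightarrow> real \<times> real" where "\<phi> x = (wt \<kappa> (fst x), snd x)" for x
    have [measurable]: "\<phi> \<in> borel_measurable borel" unfolding \<phi>_def[abs_def] by measurable
    define P where "P = distr M borel (\<lambda>\<omega>. \<phi> (N h \<omega> - N 0 \<omega>, L h \<omega> - L 0 \<omega>))"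
    have law: "distr M borel (X (Suc m) i) = P" for i
    proof -
      have "real i / real (Suc m) + h = real (Suc i) / real (Suc m)"
        by (simp add: h_def add_divide_distrib del: of_nat_Suc) (simp add: add_divide_distrib)
      then have "distr M borel (\<lambda>\<omega>. (N (real (Suc i) / real (Suc m)) \<omega> - N (real i / real (Suc m)) \<omega>,
            L (real (Suc i) / real (Suc m)) \<omega> - L (real i / real (Suc m)) \<omega>)) =
          distr M borel (\<lambda>\<omega>. (N h \<omega> - N 0 \<omega>, L h \<omega> - L 0 \<omega>))" (is "distr M borel ?A = distr M borel ?B")
        using stationary[of "real i / real (Suc m)" h] by (simp add: h_def del: of_nat_Suc)
      then have "distr (distr M borel ?A) borel \<phi> = distr (distr M borel ?B) borel \<phi>" by simp
      then show ?thesis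
        by (subst (asm) (1 2) distr_distr) (auto simp: comp_def P_def X_def[abs_def] \<phi>_def simp del: of_nat_Suc)
    qed
    have ind: "indep_vars (\<lambda>_. borel) (X (Suc m)) {..<n}" for n
    proof -
      have "indep_vars (\<lambda>_. borel) (\<lambda>j \<omega>. (\<lambda>j. \<phi>) j (N (real (Suc j) / real (Suc m)) \<omega> - N (real j / real (Suc m)) \<omega>,
          L (real (Suc j) / real (Suc m)) \<omega> - L (real j / real (Suc m)) \<omega>)) {..<n}"
        by (intro indep_vars_compose2[OF indep[where g="\<lambda>j. real j / real (Suc m)"]])
           (auto simp: divide_strict_right_mono)
      then show ?thesis by (simp add: X_def[abs_def] \<phi>_def)
    qed
    have "AE \<omega> in M. (\<lambda>n. perp (\<lambda>i. X (Suc m) i \<omega>) n) \<longlonglongrightarrow> V (Suc m) \<omega>"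
      using AE_step_path[OF \<kappa>] by eventually_elim (use grid in blast)
    from perp_limit_char[OF ind law V this]
    have "(CLINT \<omega>|M. iexp (z * V (Suc m) \<omega>)) = (CLINT x|P. iexp (z * snd x) * (CLINT \<omega>|M. iexp (z * fst x * V (Suc m) \<omega>)))" .
    also have "\<dots> = (CLINT \<omega>|M. iexp (z * (L h \<omega> - L 0 \<omega>)) * (CLINT \<omega>'|M. iexp (z * wt \<kappa> (N h \<omega> - N 0 \<omega>) * V (Suc m) \<omega>')))"
    proof -
      define \<Phi> where "\<Phi> y = (CLINT \<omega>|M. iexp (y * V (Suc m) \<omega>))" for y
      interpret V: real_distribution "distr M borel (V (Suc m))" by (rule real_distribution_distr) simp
      have "\<Phi> = char (distr M borel (V (Suc m)))"
        unfolding \<Phi>_def char_def by (rule ext, subst integral_distr) auto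
      then have [measurable]: "\<Phi> \<in> borel_measurable borel" by simp
      have "(CLINT x|P. iexp (z * snd x) * \<Phi> (z * fst x)) = (CLINT \<omega>|M. iexp (z * (L h \<omega> - L 0 \<omega>)) * \<Phi> (z * wt \<kappa> (N h \<omega> - N 0 \<omega>)))"
        unfolding P_def by (subst integral_distr) (auto simp: \<phi>_def)
      then show ?thesis unfolding \<Phi>_def .
    qed
    also have "\<dots> = (CLINT \<omega>|M. iexp (z * L h \<omega>) * (CLINT \<omega>'|M. iexp (z * wt \<kappa> (N h \<omega>) * V (Suc m) \<omega>')))"
    proof -
      define \<Phi> where "\<Phi> y = (CLINT \<omega>|M. iexp (y * V (Suc m) \<omega>))" for y
      interpret V: real_distribution "distr M borel (V (Suc m))" by (rule real_distribution_distr) simp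
      have "\<Phi> = char (distr M borel (V (Suc m)))"
        unfolding \<Phi>_def char_def by (rule ext, subst integral_distr) auto
      then have [measurable]: "\<Phi> \<in> borel_measurable borel" by simp
      have "(CLINT \<omega>|M. iexp (z * (L h \<omega> - L 0 \<omega>)) * \<Phi> (z * wt \<kappa> (N h \<omega> - N 0 \<omega>))) = (CLINT \<omega>|M. iexp (z * L h \<omega>) * \<Phi> (z * wt \<kappa> (N h \<omega>)))"
      proof (rule integral_cong_AE)
        show "AE \<omega> in M. iexp (z * (L h \<omega> - L 0 \<omega>)) * \<Phi> (z * wt \<kappa> (N h \<omega> - N 0 \<omega>)) = iexp (z * L h \<omega>) * \<Phi> (z * wt \<kappa> (N h \<omega>))"
          using zero by eventually_elim simp
      qed measurable
      then show ?thesis unfolding \<Phi>_def .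
    qed
    finally show ?thesis unfolding h_def .
  qed
  have conv: "(\<lambda>m. CLINT \<omega>|M. iexp (z * V (Suc m) \<omega>)) \<longlonglongrightarrow> (CLINT \<omega>|M. iexp (z * W \<omega>))" for z
  proof (rule integral_dominated_convergence[where w="\<lambda>_. 1"])
    show "AE \<omega> in M. (\<lambda>m. iexp (z * V (Suc m) \<omega>)) \<longlonglongrightarrow> iexp (z * W \<omega>)"
      using AE_step_path[OF \<kappa>]
    proof eventually_elim
      case (elim \<omega>)
      then have "(\<lambda>m. V (Suc m) \<omega>) \<longlonglongrightarrow> W \<omega>" using limW by blast
      then show ?case by (intro tendsto_intros)
    qed
  qed auto
  show ?thesis
  proof (rule that[OF W])
    show "AE \<omega> in M. step_path.total (\<lambda>t. N t \<omega>) (\<lambda>t. L t \<omega>) \<kappa> = W \<omega>"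
      using AE_step_path[OF \<kappa>] by eventually_elim (use limW in blast)
    fix z
    define \<alpha> where "\<alpha> = complex_of_real (u + v + w) - of_real v * iexp z"
    define \<beta> where "\<beta> = complex_of_real u + of_real w * iexp (z * d)"
    define \<Phi> where "\<Phi> m y = (CLINT \<omega>|M. iexp (y * V (Suc m) \<omega>))" for m y
    have bound: "norm (\<Phi> m z * (of_nat (Suc m) * (1 - exp (- \<alpha> / of_nat (Suc m)))) - \<beta> * exp (- \<alpha> / of_nat (Suc m)) * \<Phi> m (z * \<kappa>))
        \<le> of_nat (Suc m) * (1 - exp (- (u + w) / of_nat (Suc m))) - (u + w) * exp (- (u + w) / of_nat (Suc m))" for m
    proof -
      let ?k = "real (Suc m)"
      have "norm (\<Phi> m z * (1 - exp (- ((1 / ?k) * \<alpha>))) - (1 / ?k) * \<beta> * exp (- ((1 / ?k) * \<alpha>)) * \<Phi> m (z * \<kappa>))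
        \<le> 1 - exp (- ((u + w) * (1 / ?k))) - (u + w) * (1 / ?k) * exp (- ((u + w) * (1 / ?k)))"
        unfolding \<Phi>_def \<alpha>_def \<beta>_def
        by (rule small_time_bound[OF \<kappa> _ V fix_eq]) simp
      then have "?k * norm (\<Phi> m z * (1 - exp (- ((1 / ?k) * \<alpha>))) - (1 / ?k) * \<beta> * exp (- ((1 / ?k) * \<alpha>)) * \<Phi> m (z * \<kappa>))
        \<le> ?k * (1 - exp (- ((u + w) * (1 / ?k))) - (u + w) * (1 / ?k) * exp (- ((u + w) * (1 / ?k))))"
        by (rule mult_left_mono) simp
      also have "?k * norm (\<Phi> m z * (1 - exp (- ((1 / ?k) * \<alpha>))) - (1 / ?k) * \<beta> * exp (- ((1 / ?k) * \<alpha>)) * \<Phi> m (z * \<kappa>)) =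
          norm (of_real ?k * (\<Phi> m z * (1 - exp (- ((1 / ?k) * \<alpha>))) - (1 / ?k) * \<beta> * exp (- ((1 / ?k) * \<alpha>)) * \<Phi> m (z * \<kappa>)))"
        by (simp only: norm_mult norm_of_real abs_of_nat)
      also have "of_real ?k * (\<Phi> m z * (1 - exp (- ((1 / ?k) * \<alpha>))) - (1 / ?k) * \<beta> * exp (- ((1 / ?k) * \<alpha>)) * \<Phi> m (z * \<kappa>)) =
          \<Phi> m z * (of_nat (Suc m) * (1 - exp (- \<alpha> / of_nat (Suc m)))) - \<beta> * exp (- \<alpha> / of_nat (Suc m)) * \<Phi> m (z * \<kappa>)"
        by (simp add: right_diff_distrib del: of_nat_Suc)
      also have "?k * (1 - exp (- ((u + w) * (1 / ?k))) - (u + w) * (1 / ?k) * exp (- ((u + w) * (1 / ?k)))) =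
          of_nat (Suc m) * (1 - exp (- (u + w) / of_nat (Suc m))) - (u + w) * exp (- (u + w) / of_nat (Suc m))"
        by (simp add: right_diff_distrib del: of_nat_Suc minus_add_distrib)
      finally show ?thesis .
    qed
    have exp1: "(\<lambda>m. exp (- a / of_nat (Suc m))) \<longlonglongrightarrow> 1" for a :: "'b :: {real_normed_field, banach}"
    proof -
      have "(\<lambda>m. exp (- a * (1 / of_nat (Suc m)))) \<longlonglongrightarrow> exp (- a * 0)"
        by (intro tendsto_intros LIMSEQ_Suc[OF lim_1_over_n])
      then show ?thesis by simp
    qed
    have "(\<lambda>m. \<Phi> m z * (of_nat (Suc m) * (1 - exp (- \<alpha> / of_nat (Suc m)))) - \<beta> * exp (- \<alpha> / of_nat (Suc m)) * \<Phi> m (z * \<kappa>))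
        \<longlonglongrightarrow> (CLINT \<omega>|M. iexp (z * W \<omega>)) * \<alpha> - \<beta> * 1 * (CLINT \<omega>|M. iexp (z * \<kappa> * W \<omega>))"
      unfolding \<Phi>_def by (intro tendsto_intros exp_deriv_seq exp1 conv)
    \<comment> \<open>Both terms tend to the rate \<open>u + w\<close>, so the scaled probability of
      two or more jumps tends to 0.\<close>
    moreover have "(\<lambda>m. of_nat (Suc m) * (1 - exp (- (u + w) / of_nat (Suc m))) - (u + w) * exp (- (u + w) / of_nat (Suc m)))
        \<longlonglongrightarrow> (u + w) - (u + w) * 1"
      by (intro tendsto_intros exp_deriv_seq exp1)
    ultimately have "norm ((CLINT \<omega>|M. iexp (z * W \<omega>)) * \<alpha> - \<beta> * 1 * (CLINT \<omega>|M. iexp (z * \<kappa> * W \<omega>))) \<le> (u + w) - (u + w) * 1"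
      by (intro LIMSEQ_le[OF tendsto_norm]) (use bound in blast)+
    then show "(of_real (u + v + w) - of_real v * iexp z) * (CLINT \<omega>|M. iexp (z * W \<omega>)) =
       (of_real u + of_real w * iexp (z * d)) * (CLINT \<omega>|M. iexp (z * \<kappa> * W \<omega>))"
      by (simp add: \<alpha>_def \<beta>_def mult.commute)
  qed
qed

section \<open>The characteristic functions of \<open>rho\<close> and \<open>mu\<close>\<close>

lemma rho_law:
  shows "real_distribution (rho M N L)"
    and "(of_real (u + v + w) - of_real v * iexp z) * char (rho M N L) z = of_real u + of_real w * iexp (z * d)"
proof -
  obtain W where W: "W \<in> borel_measurable M"
      "AE \<omega> in M. step_path.total (\<lambda>t. N t \<omega>) (\<lambda>t. L t \<omega>) 0 = W \<omega>"
      "\<And>z. (of_real (u + v + w) - of_real v * iexp z) * (CLINT \<omega>|M. iexp (z * W \<omega>)) =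
         (of_real u + of_real w * iexp (z * d)) * (CLINT \<omega>|M. iexp (z * 0 * W \<omega>))"
    using functional_equation[of 0] by auto
  note [measurable] = W(1)
  have "AE \<omega> in M. L (first_jump_time (\<lambda>t. N t \<omega>)) \<omega> = W \<omega>"
    using W(2) AE_step_path[of 0, simplified] AE_jump
  proof eventually_elim
    case (elim \<omega>)
    from step_path.value_at_first_jump[OF elim(2) refl elim(3)] elim(1) show ?case by simp
  qed
  then have eq: "rho M N L = distr M borel W"
    unfolding rho_def by (rule as_distr_AE[OF W(1)])
  show "real_distribution (rho M N L)" unfolding eq by (rule real_distribution_distr) simp
  have "char (rho M N L) z = (CLINT \<omega>|M. iexp (z * W \<omega>))"
    unfolding eq char_def by (subst integral_distr) auto
  \<comment> \<open>For \<open>\<kappa> = 0\<close> the integral on the right is taken at frequency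
    0 and equals 1.\<close>
  then show "(of_real (u + v + w) - of_real v * iexp z) * char (rho M N L) z = of_real u + of_real w * iexp (z * d)"
    using W(3)[of z] by (simp add: prob_space)
qed

text \<open>With \<open>\<kappa> = inverse c\<close> the weight is the integrand of
  \<open>exp_integral\<close>, and the functional equation links the frequencies \<open>z\<close>
  and \<open>z / c\<close>.\<close>

lemma mu_law:
  assumes "c > 1"
  shows "real_distribution (mu c M N L)"
    and "(of_real (u + v + w) - of_real v * iexp z) * char (mu c M N L) z =
      (of_real u + of_real w * iexp (z * d)) * char (mu c M N L) (z / c)"
proof -
  have \<kappa>: "0 \<le> inverse c" "inverse c < 1" using assms by (auto simp: inverse_less_1_iff)
  obtain W where W: "W \<in> borel_measurable M"
      "AE \<omega> in M. step_path.total (\<lambda>t. N t \<omega>) (\<lambda>t. L t \<omega>) (inverse c) = W \<omega>"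
      "\<And>z. (of_real (u + v + w) - of_real v * iexp z) * (CLINT \<omega>|M. iexp (z * W \<omega>)) =
         (of_real u + of_real w * iexp (z * d)) * (CLINT \<omega>|M. iexp (z * inverse c * W \<omega>))"
    using functional_equation[OF \<kappa>] by auto
  note [measurable] = W(1)
  have "AE \<omega> in M. improper_exp_integral c (\<lambda>t. N t \<omega>) (\<lambda>t. L t \<omega>) = W \<omega>"
    using W(2) AE_step_path[OF \<kappa>]
  proof eventually_elim
    case (elim \<omega>)
    from step_path.improper_exp_integral_eq[OF elim(2) assms refl] elim(1) show ?case by simp
  qed
  then have eq: "mu c M N L = distr M borel W"
    unfolding mu_def by (rule as_distr_AE[OF W(1)])
  show "real_distribution (mu c M N L)" unfolding eq by (rule real_distribution_distr) simp
  have char: "char (mu c M N L) z = (CLINT \<omega>|M. iexp (z * W \<omega>))" for z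
    unfolding eq char_def by (subst integral_distr) auto
  show "(of_real (u + v + w) - of_real v * iexp z) * char (mu c M N L) z =
      (of_real u + of_real w * iexp (z * d)) * char (mu c M N L) (z / c)"
    using W(3)[of z] unfolding char divide_inverse .
qed

end

text \<open>Almost everywhere \<open>f\<close> equals the sum of its values at the three atoms times
  their indicators; the atoms are distinct because \<open>c powi (- k)\<close> is positive.\<close>

lemma three_point_integral:
  fixes f :: "real \<times> real \<Rightarrow> complex"
  assumes \<nu>: "three_point_measure c k u v w \<nu>" and "finite_measure \<nu>" and "c > 1" and nn: "u \<ge> 0" "v \<ge> 0" "w \<ge> 0"
    and [measurable]: "f \<in> borel_measurable borel"
  shows "(LINT x|\<nu>. f x) = u * f (1, 0) + v * f (0, 1) + w * f (1, c powi (- k))"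
proof -
  interpret finite_measure \<nu> by fact
  define d where "d = c powi (- k)"
  have d: "d > 0" using assms by (simp add: d_def)
  have sets[measurable_cong]: "sets \<nu> = sets borel" using \<nu> by (simp add: three_point_measure_def)
  have m: "measure \<nu> {(1, 0)} = u" "measure \<nu> {(0, 1)} = v" "measure \<nu> {(1, d)} = w"
    using \<nu> nn by (auto simp: three_point_measure_def measure_def d_def)
  have ind: "integrable \<nu> (\<lambda>x. indicator {y} x *\<^sub>R f y)" "(LINT x|\<nu>. indicator {y} x *\<^sub>R f y) = measure \<nu> {y} *\<^sub>R f y" for y
  proof -
    have y: "{y} \<in> sets \<nu>" "{y} \<inter> space \<nu> = {y}" using sets_eq_imp_space_eq[OF sets] by (auto simp: sets)
    have i: "integrable \<nu> (indicator {y} :: _ \<Rightarrow> real)"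
      using y by (intro integrable_real_indicator) (auto simp: less_top[symmetric])
    then show "integrable \<nu> (\<lambda>x. indicator {y} x *\<^sub>R f y)"
      by (rule integrable_scaleR_left)
    show "(LINT x|\<nu>. indicator {y} x *\<^sub>R f y) = measure \<nu> {y} *\<^sub>R f y"
      by (subst integral_scaleR_left) (use i y in auto)
  qed
  have "(LINT x|\<nu>. f x) = (LINT x|\<nu>. indicator {(1, 0)} x *\<^sub>R f (1, 0) + indicator {(0, 1)} x *\<^sub>R f (0, 1) + indicator {(1, d)} x *\<^sub>R f (1, d))"
  proof (rule integral_cong_AE)
    have "AE x in \<nu>. x \<notin> - {(1, 0), (0, 1), (1, d)}"
      using \<nu> by (intro AE_not_in) (auto simp: three_point_measure_def null_sets_def d_def sets)
    then show "AE x in \<nu>. f x = indicator {(1, 0)} x *\<^sub>R f (1, 0) + indicator {(0, 1)} x *\<^sub>R f (0, 1) + indicator {(1, d)} x *\<^sub>R f (1, d)"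
      by eventually_elim (use d in \<open>auto simp: indicator_def\<close>)
  qed measurable
  also have "\<dots> = u *\<^sub>R f (1, 0) + v *\<^sub>R f (0, 1) + w *\<^sub>R f (1, d)"
    by (subst Bochner_Integration.integral_add[OF Bochner_Integration.integrable_add[OF ind(1) ind(1)] ind(1)],
        subst Bochner_Integration.integral_add[OF ind(1) ind(1)]) (simp only: ind m)
  finally show ?thesis by (simp add: scaleR_conv_of_real d_def)
qed

lemma poisson_pairI:
  assumes X: "compound_poisson_process M (\<lambda>t \<omega>. (N t \<omega>, L t \<omega>)) \<nu>" and \<nu>: "three_point_measure c k u v w \<nu>"
    and c: "c > 1" and nn: "u \<ge> 0" "v \<ge> 0" "w \<ge> 0" and uw: "u + w > 0"
  shows "poisson_pair M N L u v w (c powi (- k))"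
proof -
  have levy: "levy_process M (\<lambda>t \<omega>. (N t \<omega>, L t \<omega>))" and fin: "finite_measure \<nu>"
    and ch: "\<And>t z. t \<ge> 0 \<Longrightarrow> (LINT \<omega>|M. iexp (z \<bullet> (N t \<omega>, L t \<omega>))) = exp (of_real t * (LINT x|\<nu>. (iexp (z \<bullet> x) - 1)))"
    using X unfolding compound_poisson_process_def by auto
  have ps: "prob_space M"
    and meas: "\<And>t. t \<ge> 0 \<Longrightarrow> (\<lambda>\<omega>. (N t \<omega>, L t \<omega>)) \<in> borel_measurable M"
    and indep: "\<And>(n::nat) (g :: nat \<Rightarrow> real). 0 \<le> g 0 \<Longrightarrow> (\<And>j. j < n \<Longrightarrow> g j < g (Suc j)) \<Longrightarrow>
        prob_space.indep_vars M (\<lambda>_. borel) (\<lambda>j \<omega>. (N (g (Suc j)) \<omega>, L (g (Suc j)) \<omega>) - (N (g j) \<omega>, L (g j) \<omega>)) {..<n}"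
    and zero: "AE \<omega> in M. (N 0 \<omega>, L 0 \<omega>) = 0"
    and stat: "\<And>s t. s \<ge> 0 \<Longrightarrow> t \<ge> 0 \<Longrightarrow> distr M borel (\<lambda>\<omega>. (N (s + t) \<omega>, L (s + t) \<omega>) - (N s \<omega>, L s \<omega>)) =
        distr M borel (\<lambda>\<omega>. (N t \<omega>, L t \<omega>) - (N 0 \<omega>, L 0 \<omega>))"
    and cadlag: "AE \<omega> in M. cadlag (\<lambda>t. (N t \<omega>, L t \<omega>))"
    using levy unfolding levy_process_def by auto
  interpret prob_space M by fact
  show ?thesis
  proof
    show "0 < c powi (- k)" using c by simp
    show "N t \<in> borel_measurable M" if "0 \<le> t" for t
      using measurable_compose[OF meas[OF that] measurable_fst_borel] by simp
    show "L t \<in> borel_measurable M" if "0 \<le> t" for t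
      using measurable_compose[OF meas[OF that] measurable_snd_borel] by simp
    show "AE \<omega> in M. N 0 \<omega> = 0 \<and> L 0 \<omega> = 0"
      using zero by (simp add: zero_prod_def)
    show "AE \<omega> in M. \<forall>t\<ge>0. ((\<lambda>t. N t \<omega>) \<longlongrightarrow> N t \<omega>) (at_right t) \<and> ((\<lambda>t. L t \<omega>) \<longlongrightarrow> L t \<omega>) (at_right t)"
      using cadlag
    proof eventually_elim
      case (elim \<omega>)
      show ?case
      proof (intro allI impI)
        fix t :: real assume "0 \<le> t"
        with elim have "((\<lambda>t. (N t \<omega>, L t \<omega>)) \<longlongrightarrow> (N t \<omega>, L t \<omega>)) (at_right t)"
          by (auto simp: cadlag_def)
        from tendsto_fst[OF this] tendsto_snd[OF this]
        show "((\<lambda>t. N t \<omega>) \<longlongrightarrow> N t \<omega>) (at_right t) \<and> ((\<lambda>t. L t \<omega>) \<longlongrightarrow> L t \<omega>) (at_right t)" by simp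
      qed
    qed
    show "indep_vars (\<lambda>_. borel) (\<lambda>j \<omega>. (N (g (Suc j)) \<omega> - N (g j) \<omega>, L (g (Suc j)) \<omega> - L (g j) \<omega>)) {..<n}"
      if "0 \<le> g 0" "\<And>j. j < n \<Longrightarrow> g j < g (Suc j)" for g and n :: nat
      using indep[OF that] by simp
    show "distr M borel (\<lambda>\<omega>. (N (s + t) \<omega> - N s \<omega>, L (s + t) \<omega> - L s \<omega>)) =
        distr M borel (\<lambda>\<omega>. (N t \<omega> - N 0 \<omega>, L t \<omega> - L 0 \<omega>))" if "0 \<le> s" "0 \<le> t" for s t
      using stat[OF that] by simp
    show "(CLINT \<omega>|M. iexp (x * N t \<omega> + z * L t \<omega>)) =
       exp (t * (u * (iexp x - 1) + v * (iexp z - 1) + w * (iexp (x + z * c powi (- k)) - 1)))" if t: "0 \<le> t" for t x z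
    proof -
      have "(\<lambda>y. iexp ((x, z) \<bullet> y) - 1) \<in> borel_measurable borel"
        by (intro borel_measurable_continuous_onI continuous_intros)
      from three_point_integral[OF \<nu> fin c nn this]
      have "(LINT y|\<nu>. iexp ((x, z) \<bullet> y) - 1) = u * (iexp x - 1) + v * (iexp z - 1) + w * (iexp (x + z * c powi (- k)) - 1)"
        by (simp add: inner_prod_def)
      with ch[OF t, of "(x, z)"] show ?thesis by (simp add: inner_prod_def)
    qed
  qed (use nn uw in auto)
qed

section \<open>Mixtures and infinite products\<close>

text \<open>\<open>G'\<close> is the law of a variable with law \<open>G\<close> shifted by
  \<open>a\<close> on an independent Bernoulli event of probability \<open>s\<close>. It yields both
  the formula for \<open>\<rho> k\<close> and the mixture relating \<open>\<mu> k\<close> to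
  \<open>\<mu> (k + 1)\<close>.\<close>

lemma bernoulli_shift_mixture:
  fixes G :: "real measure" and s a :: real
  assumes "real_distribution G" and s: "0 \<le> s" "s \<le> 1"
  obtains G' where "real_distribution G'"
    "\<And>z. char G' z = (of_real (1 - s) + of_real s * iexp (a * z)) * char G z"
    "\<And>B. B \<in> sets borel \<Longrightarrow> emeasure G' B = ennreal (1 - s) * emeasure G B + ennreal s * emeasure G ((\<lambda>x. x - a) ` B)"
proof -
  interpret G: real_distribution G by fact
  define Q where "Q = bernoulli_pmf s"
  interpret QG: pair_prob_space "measure_pmf Q" G ..
  define R where "R = measure_pmf Q \<Otimes>\<^sub>M G"
  interpret R: prob_space R unfolding R_def by (rule QG.prob_space_axioms)
  define f where "f x = snd x + (if fst x then a else 0)" for x :: "bool \<times> real"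
  have [measurable]: "f \<in> borel_measurable R" unfolding f_def[abs_def] R_def by measurable
  have "char (distr R borel f) z = (of_real (1 - s) + of_real s * iexp (a * z)) * char G z" for z
  proof -
    have "char (distr R borel f) z = (CLINT x|R. iexp (z * f x))"
      unfolding char_def by (subst integral_distr) auto
    also have "\<dots> = (CLINT b|measure_pmf Q. CLINT y|G. iexp (z * f (b, y)))"
      unfolding R_def
      by (subst QG.integral_fst'[symmetric]) (auto simp: R_def[symmetric] intro!: R.integrable_const_bound[of _ 1])
    also have "\<dots> = (CLINT b|measure_pmf Q. (if b then iexp (a * z) else 1) * char G z)"
    proof (rule Bochner_Integration.integral_cong[OF refl])
      fix b
      have "(CLINT y|G. iexp (z * f (b, y))) = (CLINT y|G. (if b then iexp (a * z) else 1) * iexp (z * y))"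
        by (intro Bochner_Integration.integral_cong) (auto simp: f_def exp_add[symmetric] algebra_simps)
      then show "(CLINT y|G. iexp (z * f (b, y))) = (if b then iexp (a * z) else 1) * char G z"
        by (simp add: char_def)
    qed
    also have "\<dots> = (of_real (1 - s) + of_real s * iexp (a * z)) * char G z"
      unfolding Q_def using s by (subst integral_measure_pmf[of UNIV]) (auto simp: UNIV_bool scaleR_conv_of_real algebra_simps)
    finally show ?thesis .
  qed
  moreover have "emeasure (distr R borel f) B = ennreal (1 - s) * emeasure G B + ennreal s * emeasure G ((\<lambda>x. x - a) ` B)"
    if B[measurable]: "B \<in> sets borel" for B
  proof -
    have img: "(\<lambda>x. x - a) ` B = {y. y + a \<in> B}" by (auto simp: image_iff intro!: bexI[of _ "_ + a"])
    have "emeasure (distr R borel f) B = (\<integral>\<^sup>+x. indicator B x \<partial>distr R borel f)" by simp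
    also have "\<dots> = (\<integral>\<^sup>+x. indicator B (f x) \<partial>R)" by (subst nn_integral_distr) auto
    also have "\<dots> = (\<integral>\<^sup>+b. \<integral>\<^sup>+y. indicator B (f (b, y)) \<partial>G \<partial>measure_pmf Q)"
      unfolding R_def by (subst G.nn_integral_fst[symmetric]) (auto simp: R_def[symmetric])
    also have "\<dots> = ennreal s * (\<integral>\<^sup>+y. indicator B (f (True, y)) \<partial>G) + ennreal (1 - s) * (\<integral>\<^sup>+y. indicator B (f (False, y)) \<partial>G)"
      unfolding Q_def using s by (simp add: mult.commute)
    also have "(\<integral>\<^sup>+y. indicator B (f (False, y)) \<partial>G) = emeasure G B"
      by (simp add: f_def)
    also have "(\<integral>\<^sup>+y. indicator B (f (True, y)) \<partial>G) = (\<integral>\<^sup>+y. indicator {y. y + a \<in> B} y \<partial>G)"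
      by (intro nn_integral_cong) (auto simp: f_def indicator_def)
    also have "\<dots> = emeasure G ((\<lambda>x. x - a) ` B)"
      unfolding img by (rule nn_integral_indicator) (use measurable_sets_borel[of "\<lambda>y. y + a" borel B] in \<open>auto simp: vimage_def\<close>)
    finally show ?thesis by (simp add: add.commute)
  qed
  ultimately show ?thesis by (intro that[of "distr R borel f"] R.real_distribution_distr) auto
qed

text \<open>In the application this is the law of the number of \<open>(0, 1)\<close> jumps
  preceding the first jump of \<open>N\<close>; it accounts for the denominator of the
  characteristic function of \<open>\<rho> k\<close>.\<close>

lemma geometric_distribution:
  fixes q :: real
  assumes q: "0 \<le> q" "q < 1"
  obtains G where "real_distribution G"
    "\<And>z. char G z = (1 - of_real q) / (1 - of_real q * iexp z)"
    "\<And>B. B \<in> sets borel \<Longrightarrow> emeasure G B = (\<Sum>m. ennreal (q ^ m * (1 - q)) * indicator B (real m))"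
proof -
  define P where "P = geometric_pmf (1 - q)"
  have pmf: "pmf P m = q ^ m * (1 - q)" for m using q by (simp add: P_def)
  have rd: "real_distribution (distr (measure_pmf P) borel real)"
    by (rule prob_space.real_distribution_distr[OF prob_space_measure_pmf]) simp
  have char: "char (distr (measure_pmf P) borel real) z = (1 - of_real q) / (1 - of_real q * iexp z)" for z
  proof -
    define g where "g m = pmf P m *\<^sub>R iexp (z * real m)" for m
    have g: "g m = of_real (1 - q) * (of_real q * iexp z) ^ m" for m
      by (simp add: g_def pmf scaleR_conv_of_real power_mult_distrib exp_of_nat_mult[symmetric] mult_ac)
    have "norm (of_real q * iexp z) < 1" using q by (simp add: norm_mult)
    note geom = geometric_sums[OF this] summable_geometric[of "norm (of_real q * iexp z)"]
    have "summable (\<lambda>m. norm (g m))"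
      using geom(2) \<open>norm (of_real q * iexp z) < 1\<close> by (simp add: g norm_mult norm_power summable_mult)
    then have int: "integrable (count_space UNIV) g"
      by (simp add: integrable_count_space_nat_iff)
    have "char (distr (measure_pmf P) borel real) z = integral\<^sup>L (count_space UNIV) g"
      unfolding char_def measure_pmf_eq_density g_def
      by (subst integral_distr, simp, simp, subst integral_density) auto
    moreover have s1: "g sums integral\<^sup>L (count_space UNIV) g"
      by (rule sums_integral_count_space_nat[OF int])
    moreover have s2: "g sums (of_real (1 - q) * (1 / (1 - of_real q * iexp z)))"
      unfolding g by (intro sums_mult geom)
    ultimately show ?thesis using sums_unique2[OF s1 s2] by simp
  qed
  have "emeasure (distr (measure_pmf P) borel real) B = (\<Sum>m. ennreal (q ^ m * (1 - q)) * indicator B (real m))"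
    if B[measurable]: "B \<in> sets borel" for B
  proof -
    have "emeasure (distr (measure_pmf P) borel real) B = (\<integral>\<^sup>+x. indicator B x \<partial>distr (measure_pmf P) borel real)"
      by simp
    also have "\<dots> = (\<integral>\<^sup>+m. indicator B (real m) \<partial>measure_pmf P)"
      by (subst nn_integral_distr) auto
    also have "\<dots> = (\<integral>\<^sup>+m. ennreal (pmf P m) * indicator B (real m) \<partial>count_space UNIV)"
      unfolding measure_pmf_eq_density by (subst nn_integral_density) auto
    finally show ?thesis by (simp add: nn_integral_count_space_nat pmf)
  qed
  with rd char show ?thesis by (intro that) auto
qed

text \<open>A zero forces \<open>r\<close> to be nonzero, and at any two zeros
  \<open>iexp (a * y)\<close> takes the same value, so they differ by an integer multiple of
  \<open>2 * pi / a\<close>.\<close>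

lemma countable_iexp_zeros:
  fixes p r a :: real
  assumes "a \<noteq> 0" "p \<noteq> 0 \<or> r \<noteq> 0"
  shows "countable {y. of_real p + of_real r * iexp (a * y) = (0 :: complex)}"
proof (cases "\<exists>y0. of_real p + of_real r * iexp (a * y0) = (0 :: complex)")
  case True
  then obtain y0 where y0: "of_real p + of_real r * iexp (a * y0) = (0 :: complex)" by blast
  have "r \<noteq> 0" using y0 assms(2) by auto
  have "{y. of_real p + of_real r * iexp (a * y) = (0 :: complex)} \<subseteq> range (\<lambda>j::int. y0 + 2 * pi * real_of_int j / a)"
  proof
    fix y assume "y \<in> {y. of_real p + of_real r * iexp (a * y) = (0 :: complex)}"
    then have "of_real p + of_real r * iexp (a * y) = of_real p + of_real r * iexp (a * y0)"
      by (simp only: mem_Collect_eq y0)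
    then have "of_real r * iexp (a * y) = of_real r * iexp (a * y0)"
      by (simp only: add_left_cancel)
    then have "iexp (a * y) = iexp (a * y0)" using \<open>r \<noteq> 0\<close> by simp
    then obtain j :: int where "\<i> * complex_of_real (a * y) = \<i> * complex_of_real (a * y0) + of_int (2 * j) * pi * \<i>"
      using exp_eq by blast
    then have "Im (\<i> * complex_of_real (a * y)) = Im (\<i> * complex_of_real (a * y0) + of_int (2 * j) * pi * \<i>)" by simp
    then have "a * y = a * y0 + 2 * real_of_int j * pi" by simp
    then have "y = y0 + 2 * pi * real_of_int j / a" using assms(1) by (simp add: field_simps)
    then show "y \<in> range (\<lambda>j::int. y0 + 2 * pi * real_of_int j / a)" by blast
  qed
  then show ?thesis by (rule countable_subset) simp
qed simp

text \<open>Characteristic functions are continuous, so the set where they differ is open; a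
  nonempty open set of reals is not contained in a countable one.\<close>

lemma char_eq_off_countable:
  assumes "real_distribution G" "real_distribution H" "countable A"
    and eq: "\<And>z. z \<notin> A \<Longrightarrow> char G z = char H z"
  shows "G = H"
proof (rule Levy_uniqueness[OF assms(1,2)], rule ext, rule ccontr)
  interpret G: real_distribution G by fact
  interpret H: real_distribution H by fact
  fix z assume "char G z \<noteq> char H z"
  moreover have "open {z. char G z \<noteq> char H z}"
    by (intro open_Collect_neq continuous_at_imp_continuous_on ballI G.isCont_char H.isCont_char)
  ultimately obtain x where "char G x \<noteq> char H x" "x \<notin> A"
    using open_minus_countable[OF assms(3), of "{z. char G z \<noteq> char H z}"] by blast
  with eq show False by blast
qed

section \<open>The infinite product solving the fixed-point equation\<close>

lemma norm_iexp_minus_1_le: "norm (iexp x - 1) \<le> \<bar>x\<bar>"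
  using iexp_approx1[of x 0] by simp

text \<open>The parameter \<open>a\<close> stands for \<open>c powi (-k)\<close>, so that passing
  from \<open>k\<close> to \<open>k + 1\<close> replaces \<open>a\<close> by
  \<open>a / c\<close>.\<close>

definition rho_char :: "real \<Rightarrow> real \<Rightarrow> real \<Rightarrow> real \<Rightarrow> real \<Rightarrow> complex" where
  "rho_char p q r a z = (of_real p + of_real r * iexp (a * z)) / (1 - of_real q * iexp z)"

context
  fixes c p q r a :: real
  assumes c: "c > 1" and nonneg: "p \<ge> 0" "q \<ge> 0" "r \<ge> 0" "a \<ge> 0" and sum1: "p + q + r = 1" and pr: "p + r > 0"
begin

lemma denominator_nonzero: "1 - of_real q * iexp z \<noteq> 0"
proof
  assume "1 - of_real q * iexp z = 0"
  then have "norm (of_real q * iexp z) = norm (1 :: complex)" by simp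
  then show False using nonneg sum1 pr by (simp add: norm_mult)
qed

text \<open>Substituting \<open>p = 1 - q - r\<close> writes the difference through
  \<open>iexp (a * z) - 1\<close> and \<open>iexp z - 1\<close>, both at most linear in
  \<open>z\<close>, over a denominator of norm at least \<open>1 - q\<close>. Along
  \<open>z / c ^ n\<close> the bound is geometric.\<close>

lemma norm_rho_char_minus_1_le: "norm (rho_char p q r a z - 1) \<le> (r * a + q) / (1 - q) * \<bar>z\<bar>"
proof -
  have q1: "q < 1" using nonneg sum1 pr by simp
  have "rho_char p q r a z - 1 = (of_real r * (iexp (a * z) - 1) + of_real q * (iexp z - 1)) / (1 - of_real q * iexp z)"
  proof -
    have "of_real p + of_real q + of_real r = (1 :: complex)"
      using sum1 by (metis of_real_1 of_real_add)
    then have p: "of_real p = 1 - of_real q - (of_real r :: complex)" by (simp add: algebra_simps)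
    show ?thesis unfolding rho_char_def p using denominator_nonzero[of z] by (simp add: field_simps)
  qed
  also have "norm \<dots> \<le> ((r * a + q) * \<bar>z\<bar>) / (1 - q)"
    unfolding norm_divide
  proof (rule frac_le)
    have "norm (of_real r * (iexp (a * z) - 1) + of_real q * (iexp z - 1)) \<le>
        r * norm (iexp (a * z) - 1) + q * norm (iexp z - 1)"
      using nonneg by (intro norm_triangle_le) (simp add: norm_mult)
    also have "\<dots> \<le> r * \<bar>a * z\<bar> + q * \<bar>z\<bar>"
      using nonneg by (intro add_mono mult_left_mono norm_iexp_minus_1_le)
    finally show "norm (of_real r * (iexp (a * z) - 1) + of_real q * (iexp z - 1)) \<le> (r * a + q) * \<bar>z\<bar>"
      using nonneg by (simp add: abs_mult algebra_simps)
    show "1 - q \<le> norm (1 - of_real q * iexp z)"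
      using norm_triangle_ineq2[of 1 "of_real q * iexp z"] nonneg by (simp add: norm_mult)
  qed (use nonneg q1 in auto)
  finally show ?thesis by simp
qed

lemma convergent_prod_rho_char: "convergent_prod (\<lambda>n. rho_char p q r a (z / c ^ n))"
proof (rule abs_convergent_prod_imp_convergent_prod, rule summable_imp_abs_convergent_prod)
  have "summable (\<lambda>n. (r * a + q) / (1 - q) * \<bar>z\<bar> * (1 / c) ^ n)"
    using c by (intro summable_mult summable_geometric) simp
  then show "summable (\<lambda>n. norm (rho_char p q r a (z / c ^ n) - 1))"
  proof (rule summable_comparison_test')
    show "norm (norm (rho_char p q r a (z / c ^ n) - 1)) \<le> (r * a + q) / (1 - q) * \<bar>z\<bar> * (1 / c) ^ n" for n
      using norm_rho_char_minus_1_le[of "z / c ^ n"] c by (simp add: power_divide)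
  qed
qed

lemma tendsto_scaled: "(\<lambda>n. z / c ^ n) \<longlonglongrightarrow> 0"
proof -
  have "(\<lambda>n. z * (1 / c) ^ n) \<longlonglongrightarrow> z * 0"
    using c by (intro tendsto_mult tendsto_const LIMSEQ_realpow_zero) auto
  then show ?thesis by (simp add: power_divide)
qed

text \<open>Iterating the equation leaves the remainder \<open>\<phi> (z / c ^ n)\<close>, which
  tends to \<open>\<phi> 0 = 1\<close>. No division by a factor occurs, so vanishing factors do no
  harm.\<close>

lemma fixed_point_has_prod:
  assumes cont: "isCont \<phi> 0" and one: "\<phi> 0 = 1" and eq: "\<And>z. \<phi> z = rho_char p q r a z * \<phi> (z / c)"
  shows "(\<lambda>n. rho_char p q r a (z / c ^ n)) has_prod \<phi> z"
proof -
  have prod: "\<phi> z = (\<Prod>i<n. rho_char p q r a (z / c ^ i)) * \<phi> (z / c ^ n)" for n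
  proof (induction n)
    case (Suc n)
    then show ?case using eq[of "z / c ^ n"] by (simp add: mult_ac divide_simps)
  qed simp
  have hp: "(\<lambda>n. rho_char p q r a (z / c ^ n)) has_prod prodinf (\<lambda>n. rho_char p q r a (z / c ^ n))"
    using convergent_prod_rho_char by (rule convergent_prod_has_prod)
  have "(\<lambda>n. \<phi> (z / c ^ n)) \<longlonglongrightarrow> 1"
    using isCont_tendsto_compose[OF cont tendsto_scaled] by (simp add: one)
  with has_prod_imp_tendsto'[OF hp]
  have "(\<lambda>n. (\<Prod>i<n. rho_char p q r a (z / c ^ i)) * \<phi> (z / c ^ n)) \<longlonglongrightarrow> prodinf (\<lambda>n. rho_char p q r a (z / c ^ n)) * 1"
    by (rule tendsto_mult)
  then have "(\<lambda>n. \<phi> z) \<longlonglongrightarrow> prodinf (\<lambda>n. rho_char p q r a (z / c ^ n))"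
    unfolding prod[symmetric] by simp
  then have "\<phi> z = prodinf (\<lambda>n. rho_char p q r a (z / c ^ n))"
    by (simp add: LIMSEQ_const_iff)
  with hp show ?thesis by simp
qed

end

text \<open>Passing from \<open>a\<close> to \<open>a / c\<close> shifts the numerators of the infinite product by one place
  and leaves the denominators in place; comparing partial products avoids dividing by a
  numerator that may vanish.\<close>

lemma fixed_point_shift:
  fixes c p q r a :: real and \<phi> \<psi> :: "real \<Rightarrow> complex"
  assumes c: "c > 1" and nonneg: "p \<ge> 0" "q \<ge> 0" "r \<ge> 0" "a \<ge> 0" and sum1: "p + q + r = 1" and pr: "p + r > 0"
    and \<phi>: "isCont \<phi> 0" "\<phi> 0 = 1" "\<And>z. \<phi> z = rho_char p q r a z * \<phi> (z / c)"
    and \<psi>: "isCont \<psi> 0" "\<psi> 0 = 1" "\<And>z. \<psi> z = rho_char p q r (a / c) z * \<psi> (z / c)"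
  shows "\<psi> z = \<phi> (z / c) * ((1 - of_real q) / (1 - of_real q * iexp z))"
proof -
  define D where "D y = 1 - of_real q * iexp y" for y
  note asm = c nonneg sum1 pr
  have D: "D y \<noteq> 0" for y unfolding D_def by (rule denominator_nonzero[OF asm])
  have ac: "a / c \<ge> 0" using c nonneg by simp
  \<comment> \<open>The denominators on the left run through \<open>z\<close> to
    \<open>z / c ^ (n - 1)\<close>, those on the right through \<open>z / c\<close> to
    \<open>z / c ^ n\<close>; only the two end factors remain.\<close>
  have part: "(\<Prod>i<n. rho_char p q r (a / c) (z / c ^ i)) * D z = (\<Prod>i<n. rho_char p q r a (z / c / c ^ i)) * D (z / c ^ n)" for n
  proof (induction n)
    case (Suc n)
    \<comment> \<open>Both sides equal the same numerator, because
      \<open>(a / c) * (z / c ^ n) = a * (z / c / c ^ n)\<close>.\<close>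
    have "rho_char p q r (a / c) (z / c ^ n) * D (z / c ^ n) = rho_char p q r a (z / c / c ^ n) * D (z / c ^ Suc n)"
      using D[of "z / c ^ n"] D[of "z / c ^ Suc n"]
      unfolding rho_char_def D_def
      by (simp add: mult_ac)
    note step = this
    let ?A = "\<Prod>i<n. rho_char p q r (a / c) (z / c ^ i)" and ?B = "\<Prod>i<n. rho_char p q r a (z / c / c ^ i)"
    have "?A * rho_char p q r (a / c) (z / c ^ n) * D z = (?A * D z) * rho_char p q r (a / c) (z / c ^ n)"
      by (simp only: mult_ac)
    also have "\<dots> = ?B * (rho_char p q r (a / c) (z / c ^ n) * D (z / c ^ n))"
      unfolding Suc by (simp only: mult_ac)
    also have "\<dots> = ?B * rho_char p q r a (z / c / c ^ n) * D (z / c ^ Suc n)"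
      unfolding step by (simp only: mult_ac)
    finally show ?case by simp
  qed simp
  have lim1: "(\<lambda>n. (\<Prod>i<n. rho_char p q r (a / c) (z / c ^ i)) * D z) \<longlonglongrightarrow> \<psi> z * D z"
    by (intro tendsto_mult tendsto_const has_prod_imp_tendsto' fixed_point_has_prod[OF c nonneg(1-3) ac sum1 pr \<psi>])
  have "isCont D 0" unfolding D_def by (intro continuous_intros)
  then have "(\<lambda>n. D (z / c ^ n)) \<longlonglongrightarrow> D 0"
    using isCont_tendsto_compose tendsto_scaled[OF asm] by blast
  then have "(\<lambda>n. (\<Prod>i<n. rho_char p q r a (z / c / c ^ i)) * D (z / c ^ n)) \<longlonglongrightarrow> \<phi> (z / c) * D 0"
    by (intro tendsto_mult has_prod_imp_tendsto' fixed_point_has_prod[OF asm \<phi>])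
  then have "\<psi> z * D z = \<phi> (z / c) * D 0"
    unfolding part[symmetric] using lim1 LIMSEQ_unique by blast
  then show ?thesis using D[of z] by (simp add: D_def field_simps)
qed

section \<open>The theorem\<close>

theorem proposition2p3:
  fixes c p q r u v w :: real
    and \<nu> :: "int \<Rightarrow> (real \<times> real) measure"
    and M :: "int \<Rightarrow> 'a measure"
    and N L :: "int \<Rightarrow> real \<Rightarrow> 'a \<Rightarrow> real"
    and \<rho> \<mu> :: "int \<Rightarrow> real measure"
  assumes "c > 1"
    and "u \<ge> 0" "v \<ge> 0" "w \<ge> 0"
    and "p = u / (u + v + w)" "q = v / (u + v + w)" "r = w / (u + v + w)"
    and "p \<ge> 0" "q \<ge> 0" "r \<ge> 0" "p + q + r = 1" "p + r > 0" "q + r > 0"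
    and "\<And>k. three_point_measure c k u v w (\<nu> k)"
    and "\<And>k. compound_poisson_process (M k) (\<lambda>t \<omega>. (N k t \<omega>, L k t \<omega>)) (\<nu> k)"
    and "\<And>k. \<rho> k = rho (M k) (N k) (L k)"
    and "\<And>k. \<mu> k = mu c (M k) (N k) (L k)"
  shows "\<forall>k.
     (\<forall>B\<in>sets borel. emeasure (\<rho> k) B =
        (\<Sum>m. ennreal (q ^ m * p) * emeasure (return borel (real m)) B) +
        (\<Sum>m. ennreal (q ^ m * r) * emeasure (return borel (real m + c powi (-k))) B)) \<and>
     (\<forall>z. char (\<rho> k) z =
        (of_real p + of_real r * iexp (c powi (-k) * z)) / (1 - of_real q * iexp z)) \<and>
     (\<forall>z. (\<lambda>n. (of_real p + of_real r * iexp (c powi (-k - int n) * z)) /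
              (1 - of_real q * iexp (c powi (- int n) * z))) has_prod char (\<mu> k) z) \<and>
     (\<forall>z. char (\<mu> k) z = char (\<mu> (k + 1)) z *
        (of_real (p / (p + r)) + of_real (r / (p + r)) * iexp (c powi (-k) * z))) \<and>
     (\<forall>B\<in>sets borel. measure (\<mu> k) B =
        p / (p + r) * measure (\<mu> (k + 1)) B +
        r / (p + r) * measure (\<mu> (k + 1)) ((\<lambda>x. x - c powi (-k)) ` B)) \<and>
     (\<forall>z. char (\<mu> (k + 1)) z =
        char (\<mu> k) (inverse c * z) * ((1 - of_real q) / (1 - of_real q * iexp z))) \<and>
     (\<forall>z. char (\<mu> k) z = char (\<rho> k) z * char (\<mu> k) (inverse c * z)) \<and>
     (\<forall>\<sigma>. real_distribution \<sigma> \<longrightarrow>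
        (\<forall>z. char (\<mu> k) z = char \<sigma> z * char (\<mu> k) (inverse c * z)) \<longrightarrow> \<sigma> = \<rho> k)"
proof -
  define s where "s = u + v + w"
  \<comment> \<open>Division by zero gives 0, so \<open>s = 0\<close> would make \<open>p\<close>,
    \<open>q\<close> and \<open>r\<close> all vanish, against \<open>p + q + r = 1\<close>.\<close>
  have s0: "s \<noteq> 0"
    using assms(5-7,11) by (auto simp: s_def)
  then have uvw: "u = p * s" "v = q * s" "w = r * s" and s: "s > 0"
    using assms(2-7) by (auto simp: s_def)
  then have uw: "u + w > 0"
    using assms(12) by (metis distrib_right mult_pos_pos)
  note c = assms(1)
  have q: "0 \<le> q" "q < 1" and q1: "1 - q = p + r" using assms(8-12) by auto
  have qc: "1 - complex_of_real q = of_real (p + r)" by (simp flip: q1)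
  define a where "a k = c powi (- k)" for k
  have a: "a k > 0" "a (k + 1) = a k / c" for k
    using c by (auto simp: a_def power_int_diff power_int_minus divide_inverse power_int_add)
  have nonneg: "p \<ge> 0" "q \<ge> 0" "r \<ge> 0" "a k \<ge> 0" for k
    using assms(8-10) a(1)[of k] by auto
  note asm = c nonneg assms(11,12)
  have den: "1 - of_real q * iexp z \<noteq> 0" for z by (rule denominator_nonzero[OF asm])
  have pair: "poisson_pair (M k) (N k) (L k) u v w (a k)" for k
    unfolding a_def by (rule poisson_pairI[OF assms(15,14) c assms(2-4) uw])
  have rate: "of_real (u + v + w) - of_real v * iexp z = of_real s * (1 - of_real q * iexp z)"
    "of_real u + of_real w * iexp (z * a k) = of_real s * (of_real p + of_real r * iexp (a k * z))" for z k
    unfolding s_def[symmetric] by (simp_all add: uvw algebra_simps)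
  have rd_rho: "real_distribution (\<rho> k)" for k
    unfolding assms(16) by (rule poisson_pair.rho_law(1)[OF pair])
  have rd_mu: "real_distribution (\<mu> k)" for k
    unfolding assms(17) by (rule poisson_pair.mu_law(1)[OF pair c])
  have cancel: "x = n / D" if "of_real s * D * x = of_real s * n" "D \<noteq> 0" for x n D :: complex
  proof -
    have "D * x = n" using that(1) s by (simp add: mult.assoc)
    then show ?thesis using that(2) by (simp add: field_simps)
  qed
  have char_rho: "char (\<rho> k) z = rho_char p q r (a k) z" for k z
    using poisson_pair.rho_law(2)[OF pair, of z k]
    unfolding rate assms(16)[symmetric] rho_char_def by (rule cancel[OF _ den])
  have char_mu: "char (\<mu> k) z = rho_char p q r (a k) z * char (\<mu> k) (z / c)" for k z
  proof -
    have "of_real s * (1 - of_real q * iexp z) * char (\<mu> k) z =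
        of_real s * ((of_real p + of_real r * iexp (a k * z)) * char (\<mu> k) (z / c))"
      using poisson_pair.mu_law(2)[OF pair c, of z k] unfolding rate assms(17)[symmetric]
      by (simp only: mult.assoc)
    from cancel[OF this den] show ?thesis by (simp add: rho_char_def)
  qed
  have mu_fp: "isCont (char (\<mu> k)) 0" "char (\<mu> k) 0 = 1" for k
    using real_distribution.isCont_char[OF rd_mu] real_distribution.char_zero[OF rd_mu] by auto
  have shift: "char (\<mu> (k + 1)) z = char (\<mu> k) (z / c) * ((1 - of_real q) / (1 - of_real q * iexp z))" for k z
  proof (rule fixed_point_shift[OF asm])
    show "char (\<mu> (k + 1)) z = rho_char p q r (a k / c) z * char (\<mu> (k + 1)) (z / c)" for z
      using char_mu[of "k + 1" z] by (simp add: a(2))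
  qed (rule mu_fp char_mu)+
  \<comment> \<open>Rewriting with \<open>shift\<close> produces the factor
    \<open>1 - q = p + r\<close>, which cancels the normalisation of the mixture; what remains is
    the fixed-point equation for \<open>k\<close>.\<close>
  have mix: "char (\<mu> k) z = char (\<mu> (k + 1)) z *
        (of_real (p / (p + r)) + of_real (r / (p + r)) * iexp (a k * z))" for k z
  proof -
    have "char (\<mu> (k + 1)) z * (of_real (p / (p + r)) + of_real (r / (p + r)) * iexp (a k * z)) =
        char (\<mu> k) (z / c) * (of_real p + of_real r * iexp (a k * z)) / (1 - of_real q * iexp z)"
    proof -
      have "complex_of_real (p / (p + r)) + of_real (r / (p + r)) * iexp (a k * z) =
          (of_real p + of_real r * iexp (a k * z)) / of_real (p + r)"
        by (simp add: add_divide_distrib)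
      moreover have "complex_of_real (p + r) \<noteq> 0" using assms(12) by (simp only: of_real_eq_0_iff)
      moreover have "X * (Q / D) * (n / Q) = X * n / D" if "Q \<noteq> 0" for X Q D n :: complex
        using that by simp
      ultimately show ?thesis unfolding shift qc by (simp only:)
    qed
    also have "\<dots> = char (\<mu> k) z"
      unfolding char_mu[of k z] rho_char_def by simp
    finally show ?thesis by simp
  qed
  \<comment> \<open>The Bernoulli weight: since \<open>1 - q = p + r\<close>,
    \<open>rho_char\<close> is the Bernoulli factor with parameter \<open>t\<close> times the
    characteristic function of the geometric law.\<close>
  define t where "t = r / (p + r)"
  have t: "0 \<le> t" "t \<le> 1" "1 - t = p / (p + r)"
    using assms(8,10,12) by (auto simp: t_def field_simps)
  have rho_formula: "emeasure (\<rho> k) B =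
        (\<Sum>m. ennreal (q ^ m * p) * emeasure (return borel (real m)) B) +
        (\<Sum>m. ennreal (q ^ m * r) * emeasure (return borel (real m + a k)) B)" if B: "B \<in> sets borel" for k B
  proof -
    obtain G where G: "real_distribution G" "\<And>z. char G z = (1 - of_real q) / (1 - of_real q * iexp z)"
      "\<And>B. B \<in> sets borel \<Longrightarrow> emeasure G B = (\<Sum>m. ennreal (q ^ m * (1 - q)) * indicator B (real m))"
      using geometric_distribution[OF q] by blast
    obtain G' where G': "real_distribution G'"
      "\<And>z. char G' z = (of_real (1 - t) + of_real t * iexp (a k * z)) * char G z"
      "\<And>B. B \<in> sets borel \<Longrightarrow> emeasure G' B = ennreal (1 - t) * emeasure G B + ennreal t * emeasure G ((\<lambda>x. x - a k) ` B)"
      using bernoulli_shift_mixture[OF G(1) t(1,2), of "a k"] by blast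
    have "char (\<rho> k) z = char G' z" for z
    proof -
      have "(of_real (1 - t) + of_real t * iexp (a k * z)) * (1 - of_real q) = of_real p + of_real r * iexp (a k * z)"
      proof -
        have "(1 - t) * (1 - q) = p" "t * (1 - q) = r"
          unfolding q1 t(3) using assms(12) by (auto simp: t_def)
        then have "complex_of_real (1 - t) * of_real (1 - q) = of_real p" "complex_of_real t * of_real (1 - q) = of_real r"
          by (simp_all only: of_real_mult[symmetric])
        moreover have "(of_real (1 - t) + of_real t * E) * (1 - of_real q) =
            of_real (1 - t) * of_real (1 - q) + of_real t * of_real (1 - q) * E" for E :: complex
          by (simp add: algebra_simps)
        ultimately show ?thesis by (simp only:)
      qed
      then show ?thesis unfolding char_rho G'(2) G(2) rho_char_def by simp
    qed
    then have "\<rho> k = G'" by (intro Levy_uniqueness rd_rho G'(1) ext)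
    have img: "(\<lambda>x. x - a k) ` B \<in> sets borel"
    proof -
      have "(\<lambda>x. x - a k) ` B = (\<lambda>y. y + a k) -` B" by (auto simp: image_iff intro!: bexI[of _ "_ + a k"])
      then show ?thesis using measurable_sets_borel[of "\<lambda>y. y + a k" borel B] B by simp
    qed
    have ind: "indicator ((\<lambda>x. x - a k) ` B) y = (indicator B (y + a k) :: ennreal)" for y
      by (auto simp: indicator_def image_iff intro!: bexI[of _ "y + a k"])
    have w: "ennreal (1 - t) * ennreal (q ^ m * (1 - q)) = ennreal (q ^ m * p)"
        "ennreal t * ennreal (q ^ m * (1 - q)) = ennreal (q ^ m * r)" for m
    proof -
      have "(1 - t) * (1 - q) = p" "t * (1 - q) = r"
        unfolding q1 t(3) using assms(12) by (auto simp: t_def)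
      then have "(1 - t) * (q ^ m * (1 - q)) = q ^ m * p" "t * (q ^ m * (1 - q)) = q ^ m * r"
        by (metis mult.assoc mult.commute)+
      then show "ennreal (1 - t) * ennreal (q ^ m * (1 - q)) = ennreal (q ^ m * p)"
        "ennreal t * ennreal (q ^ m * (1 - q)) = ennreal (q ^ m * r)"
        using t(1,2) q by (simp_all only: ennreal_mult'[symmetric] diff_ge_0_iff_ge)
    qed
    show ?thesis
      unfolding \<open>\<rho> k = G'\<close> G'(3)[OF B] G(3)[OF B] G(3)[OF img] ind
      by (simp only: ennreal_suminf_cmult[symmetric] mult.assoc[symmetric] w emeasure_return[OF B])
  qed
  have mu_mix: "measure (\<mu> k) B = p / (p + r) * measure (\<mu> (k + 1)) B +
        r / (p + r) * measure (\<mu> (k + 1)) ((\<lambda>x. x - a k) ` B)" if B: "B \<in> sets borel" for k B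
  proof -
    obtain G' where G': "real_distribution G'"
      "\<And>z. char G' z = (of_real (1 - t) + of_real t * iexp (a k * z)) * char (\<mu> (k + 1)) z"
      "\<And>B. B \<in> sets borel \<Longrightarrow> emeasure G' B = ennreal (1 - t) * emeasure (\<mu> (k + 1)) B + ennreal t * emeasure (\<mu> (k + 1)) ((\<lambda>x. x - a k) ` B)"
      using bernoulli_shift_mixture[OF rd_mu t(1,2), of "a k"] by blast
    have "\<mu> k = G'"
      by (intro Levy_uniqueness rd_mu G'(1) ext) (unfold G'(2) mix[of k] t(3), simp add: t_def mult.commute)
    interpret K: real_distribution "\<mu> k" by (rule rd_mu)
    interpret K1: real_distribution "\<mu> (k + 1)" by (rule rd_mu)
    have "ennreal (measure (\<mu> k) B) = ennreal ((1 - t) * measure (\<mu> (k + 1)) B + t * measure (\<mu> (k + 1)) ((\<lambda>x. x - a k) ` B))"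
      using G'(3)[OF B] t(1,2) unfolding \<open>\<mu> k = G'\<close>[symmetric] K.emeasure_eq_measure K1.emeasure_eq_measure
      by (simp add: ennreal_mult' ennreal_plus)
    then show ?thesis
      unfolding t(3) using t(1,2) assms(8,10,12)
      by (subst (asm) ennreal_inj) (auto simp: t_def)
  qed
  have product: "(\<lambda>n. (of_real p + of_real r * iexp (c powi (-k - int n) * z)) /
              (1 - of_real q * iexp (c powi (- int n) * z))) has_prod char (\<mu> k) z" for k z
  proof -
    have "(\<lambda>n. rho_char p q r (a k) (z / c ^ n)) has_prod char (\<mu> k) z"
      by (rule fixed_point_has_prod[OF asm mu_fp char_mu])
    moreover have "rho_char p q r (a k) (z / c ^ n) = (of_real p + of_real r * iexp (c powi (-k - int n) * z)) /
              (1 - of_real q * iexp (c powi (- int n) * z))" for n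
    proof -
      have "c powi (- k - int n) * z = a k * (z / c ^ n)" "c powi (- int n) * z = z / c ^ n"
        using c by (simp_all add: a_def power_int_diff power_int_minus divide_inverse)
      then show ?thesis by (simp only: rho_char_def)
    qed
    ultimately show ?thesis by simp
  qed
  have unique: "\<sigma> = \<rho> k" if \<sigma>: "real_distribution \<sigma>"
    and eq: "\<And>z. char (\<mu> k) z = char \<sigma> z * char (\<mu> k) (z / c)" for \<sigma> k
  proof (rule char_eq_off_countable[OF \<sigma> rd_rho])
    let ?Z = "{y. of_real p + of_real r * iexp (a k * y) = (0 :: complex)}"
    have "countable ?Z"
      using a(1)[of k] assms(12) by (intro countable_iexp_zeros) auto
    \<comment> \<open>If \<open>\<mu> k\<close> has a vanishing characteristic function at
      \<open>z / c\<close>, some factor of the product vanishes, so \<open>z / c / c ^ n\<close>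
      lies in \<open>?Z\<close> for some \<open>n\<close>; solving for \<open>z\<close> gives these
      images of \<open>?Z\<close>.\<close>
    then show "countable (\<Union>n. (\<lambda>y. c * (y * c ^ n)) ` ?Z)" by simp
    fix z assume z: "z \<notin> (\<Union>n. (\<lambda>y. c * (y * c ^ n)) ` ?Z)"
    have "char (\<mu> k) (z / c) \<noteq> 0"
    proof
      assume "char (\<mu> k) (z / c) = 0"
      then have "0 \<in> range (\<lambda>n. rho_char p q r (a k) (z / c / c ^ n))"
        using has_prod_eq_0_iff[OF fixed_point_has_prod[OF asm mu_fp char_mu]] by blast
      then obtain n where "rho_char p q r (a k) (z / c / c ^ n) = 0" by auto
      then have "z / c / c ^ n \<in> ?Z"
        using den[of "z / c / c ^ n"] unfolding rho_char_def divide_eq_0_iff mem_Collect_eq by blast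
      moreover have "z = c * (z / c / c ^ n * c ^ n)" using c by simp
      ultimately show False using z by blast
    qed
    with eq[of z] char_mu[of k z] show "char \<sigma> z = char (\<rho> k) z" by (simp add: char_rho)
  qed
  have inv: "inverse c * z = z / c" for z by (simp add: divide_inverse mult.commute)
  show ?thesis
    unfolding a_def[symmetric] inv
  proof (intro allI conjI ballI impI)
    fix k and z :: real
    show "char (\<rho> k) z = (of_real p + of_real r * iexp (a k * z)) / (1 - of_real q * iexp z)"
      using char_rho unfolding rho_char_def .
    show "char (\<mu> k) z = char (\<rho> k) z * char (\<mu> k) (z / c)"
      unfolding char_rho by (rule char_mu)
  next
    fix k \<sigma> assume \<sigma>: "real_distribution \<sigma>" and eq: "\<forall>z. char (\<mu> k) z = char \<sigma> z * char (\<mu> k) (z / c)"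
    show "\<sigma> = \<rho> k" by (rule unique[OF \<sigma> spec[OF eq]])
  qed (rule rho_formula product[folded a_def] mix mu_mix shift; assumption)+
qed

end
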